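(* Let $0<p\le q\le\infty$ and let $\omega=\omega_1\cdots\omega_s$ on $[-1,1]$, where the function $t\mapsto\omega_i(\cos t)$ belongs to $\Omega$ for $i=1,\dots,s$. (i) If $0<p\le q<\infty$ and $u\in A_\infty$ on $[-1,1]$, then there is a constant $C=C(p,q,\omega,u)$ such that for every integer $n\ge1$ and every algebraic polynomial $P_n$ of degree at most $n$, $$\|P_n\|_{L_q([-1,1],\,\omega u)}\le C\,n^{2/p-2/q}\,\|P_n\|_{L_p([-1,1],\,(\omega u)^{p/q})}.$$ (ii) If $q=\infty$, $0<p<\infty$ and $u\in A^*$ on $[-1,1]$, then there is a constant $C=C(p,q,\omega,u)$ such that for every integer $n\ge1$ and every algebraic polynomial $P_n$ of degree at most $n$, $$\|P_n\|_{L_\infty([-1,1],\,\omega u)}\le C\,n^{2/p}\,\|P_n\|_{L_p([-1,1],\,(\omega u)^{p})}.$$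
   Context: $\mathbb{T}=\mathbb{R}/2\pi\mathbb{Z}$. Weights on $[-1,1]$ are nonnegative integrable functions. For a weight $w$ on $[-1,1]$: $\|f\|_{L_p([-1,1],w)}=\left(\int_{-1}^1|f|^pw\right)^{1/p}$ if $0<p<\infty$ and $\|f\|_{L_\infty([-1,1],w)}=\operatorname{ess\,sup}_{x\in[-1,1]}|f(x)w(x)|$. $u\in A_\infty$ on $[-1,1]$: for every $\alpha>0$ there is $\beta>0$ such that $\int_Eu\ge\beta\int_Iu$ for any interval $I\subset[-1,1]$ and any measurable $E\subset I$ with $|E|\ge\alpha|I|$. $u\in A^*$ on $[-1,1]$: there is a constant $L$ such that $u(x)\le\frac{L}{|I|}\int_Iu$ for all intervals $I\subset[-1,1]$ and all $x\in I$. Class $\Omega$: a function $w$ on $\mathbb{T}$ belongs to $\Omega$ if $w(t)=\exp(-F(g(t)))$, $t\in\mathbb{T}$ (with $w(t)=0$ where $g(t)=0$), where for some $A>0$: - $g:\mathbb{T}\to[-A,A]$ is real analytic, i.e. for some $D>0$, $|g^{(n)}(t)|\le D^n n!$ for all $t\in\mathbb{T}$, $n\ge 1$; each zero of $g$ has multiplicity one; and $g$ has at least one zero on $\mathbb{T}$; - $F:[-A,A]\setminus\{0\}\to(0,\infty)$ is even, $C^\infty$ on $(0,A]$, and satisfies: (F1) $F(x)\to\infty$ as $x\to0+$; (F2) $F$ is decreasing on $(0,A]$; (F3) for some $B>0$, $|F^{(n)}(x)|\le B^n n^n F(x)/x^n$ for $x\in(0,A]$, $n=1,2,\dots$; (F4)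 there exist $A_1,A_2>0$ with $A_2\le |F'(x)|x/F(x)\le A_1$ for $x\in(0,A]$. *)

theory Defs
  imports "HOL-Analysis.Analysis" "HOL-Probability.Essential_Supremum"
begin

text \<open>
  \<open>d n\<close> is the \<open>n\<close>-th derivative of \<open>f\<close> on \<open>S\<close>, for every \<open>n\<close>. Derivatives are taken
  within \<open>S\<close>, hence one-sided at an endpoint of an interval \<open>S\<close>. If \<open>S\<close> has no isolated points,
  then \<open>d\<close> is unique on \<open>S\<close>, and it exists iff \<open>f\<close> is \<open>C\<^sup>\<infinity>\<close> on \<open>S\<close>.
\<close>
definition derivatives_on :: "real set \<Rightarrow> (real \<Rightarrow> real) \<Rightarrow> (nat \<Rightarrow> real \<Rightarrow> real) \<Rightarrow> bool" where
  "derivatives_on S f d \<longleftrightarrow>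
     (\<forall>x\<in>S. d 0 x = f x) \<and>
     (\<forall>n. \<forall>x\<in>S. (d n has_real_derivative d (Suc n) x) (at x within S))"

text \<open>Functions on the circle are represented by \<open>2\<pi>\<close>-periodic functions on the real line.\<close>
definition Omega_inner :: "real \<Rightarrow> (real \<Rightarrow> real) \<Rightarrow> bool" where
  "Omega_inner A g \<longleftrightarrow>
     (\<forall>t. g (t + 2 * pi) = g t) \<and>
     (\<forall>t. g t \<in> {-A..A}) \<and>
     (\<exists>d. derivatives_on UNIV g d \<and>
          (\<exists>D>0. \<forall>n\<ge>1. \<forall>t. \<bar>d n t\<bar> \<le> D ^ n * fact n) \<and>
          (\<forall>t. g t = 0 \<longrightarrow> d 1 t \<noteq> 0)) \<and>
     (\<exists>t. g t = 0)"

definition Omega_outer :: "real \<Rightarrow> (real \<Rightarrow> real) \<Rightarrow> bool" where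
  "Omega_outer A F \<longleftrightarrow>
     (\<forall>x\<in>{-A..A} - {0}. F x > 0 \<and> F (- x) = F x) \<and>
     filterlim F at_top (at_right 0) \<and>
     antimono_on {0<..A} F \<and>
     (\<exists>d. derivatives_on {0<..A} F d \<and>
          (\<exists>B>0. \<forall>n\<ge>1. \<forall>x\<in>{0<..A}. \<bar>d n x\<bar> \<le> B ^ n * real n ^ n * F x / x ^ n) \<and>
          (\<exists>A1>0. \<exists>A2>0. \<forall>x\<in>{0<..A}. A2 \<le> \<bar>d 1 x\<bar> * x / F x \<and> \<bar>d 1 x\<bar> * x / F x \<le> A1))"

definition Omega :: "(real \<Rightarrow> real) set" where
  "Omega = {w. \<exists>A>0. \<exists>g F. Omega_inner A g \<and> Omega_outer A F \<and>
                 w = (\<lambda>t. if g t = 0 then 0 else exp (- F (g t)))}"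

definition weight :: "(real \<Rightarrow> real) \<Rightarrow> bool" where
  "weight w \<longleftrightarrow> (\<forall>x\<in>{-1..1}. 0 \<le> w x) \<and> set_integrable lebesgue {-1..1} w"

definition A_infinity :: "(real \<Rightarrow> real) set" where
  "A_infinity = {u. weight u \<and>
     (\<forall>\<alpha>>0. \<exists>\<beta>>0. \<forall>I E. is_interval I \<and> I \<subseteq> {-1..1} \<and>
        E \<in> sets lebesgue \<and> E \<subseteq> I \<and> measure lebesgue E \<ge> \<alpha> * measure lebesgue I \<longrightarrow>
        (LINT x:E|lebesgue. u x) \<ge> \<beta> * (LINT x:I|lebesgue. u x))}"

text \<open>Intervals of length zero are excluded here because of the division by the length.\<close>
definition A_star :: "(real \<Rightarrow> real) set" where
  "A_star = {u. weight u \<and>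
     (\<exists>L. \<forall>I. is_interval I \<and> I \<subseteq> {-1..1} \<and> measure lebesgue I > 0 \<longrightarrow>
        (\<forall>x\<in>I. u x \<le> L / measure lebesgue I * (LINT y:I|lebesgue. u y)))}"

text \<open>
  The weight is a plain factor, not a power, in the norm for \<open>p = \<infinity>\<close>. The norm takes
  the value \<open>\<infinity>\<close> where the integral or the essential supremum is infinite.
\<close>
definition Lp_norm :: "ennreal \<Rightarrow> (real \<Rightarrow> real) \<Rightarrow> (real \<Rightarrow> real) \<Rightarrow> ennreal" where
  "Lp_norm p w f =
     (if p = \<infinity> then esssup (lebesgue_on {-1..1}) (\<lambda>x. ennreal \<bar>f x * w x\<bar>)
      else let J = (\<integral>\<^sup>+x\<in>{-1..1}. ennreal (\<bar>f x\<bar> powr enn2real p * w x) \<partial>lebesgue)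
           in if J = \<infinity> then \<infinity> else ennreal (enn2real J powr (1 / enn2real p)))"

end

theory Submission
  imports Defs "HOL-Complex_Analysis.Conformal_Mappings"
begin

text \<open>
  A weight in \<open>\<Omega>\<close> vanishes only at isolated points and increases away from them, so a product of
  such weights has at every \<open>x\<close> a segment \<open>J\<close> of fixed length, with endpoint \<open>x\<close>, on
  which it is at least a constant times its value at \<open>x\<close>. Hence only unweighted one-sided estimates
  on \<open>J\<close> are needed, and there a Markov-type inequality at the endpoint gives exactly the scale
  \<open>n\<^sup>-\<^sup>2\<close>. Cut \<open>[-1, 1]\<close> into \<open>N\<close> cells, with \<open>N\<close> of order \<open>n\<^sup>2\<close>: if \<open>x\<close> lies in
  the \<open>k\<close>-th cell, then there is a \<open>j\<close> such that \<open>\<bar>P x\<bar>\<close> is at most a constant times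
  \<open>(1 + \<bar>j - k\<bar>)\<^sup>-\<^sup>m \<bar>P y\<bar>\<close> for all \<open>y\<close> in the \<open>j\<close>-th cell, which lies in \<open>J\<close>.
  The averages of \<open>u\<close> over the cells grow at most polynomially in \<open>\<bar>j - k\<bar>\<close>, and \<open>u\<close> is comparable to
  its average on a fixed proportion of each cell, so \<open>\<bar>P\<bar>\<^sup>p (\<omega> u)\<^sup>p\<^sup>/\<^sup>q\<close> with \<open>u\<close> replaced by
  its average over a cell is bounded on that cell by \<open>N (1 + \<bar>j - k\<bar>)\<^sup>-\<^sup>2\<close> times the integral over the
  \<open>j\<close>-th one. Raising this to the power \<open>q / p\<close> and summing over the cells gives the case
  \<open>q < \<infinity>\<close>; for \<open>q = \<infinity>\<close> the condition \<open>A_star\<close> bounds \<open>u\<close> by its averages.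
\<close>

section \<open>Polynomials near their maximum\<close>

lemma poly_eq_sum:
  fixes R :: "'a::comm_semiring_1 poly"
  assumes "degree R \<le> n"
  shows "poly R x = (\<Sum>i\<le>n. coeff R i * x ^ i)"
  unfolding poly_altdef using assms by (intro sum.mono_neutral_left) (auto simp: coeff_eq_0)

text \<open>Here F z is R (cos z). Multiplied by \<open>w ^ n\<close> with w = exp (i z), it becomes
  a polynomial in w, so the maximum principle on the unit disc controls it in the upper half-plane;
  dividing by \<open>w ^ n\<close> costs the factor exp (n Im z).\<close>

lemma cos_poly_growth:
  fixes R :: "real poly" and n :: nat
  defines "F \<equiv> (\<lambda>z. \<Sum>i\<le>n. complex_of_real (coeff R i) * cos z ^ i)"
  assumes deg: "degree R \<le> n" and bd: "\<And>v. v \<in> {-1..1} \<Longrightarrow> \<bar>poly R v\<bar> \<le> M"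
  shows "cmod (F z) \<le> M * exp (real n * \<bar>Im z\<bar>)"
proof -
  define c where "c = (\<lambda>i. complex_of_real (coeff R i))"
  have F: "F z = (\<Sum>i\<le>n. c i * cos z ^ i)" for z
    unfolding F_def c_def ..
  have "F (complex_of_real t) = of_real (poly R (cos t))" for t
    unfolding F_def poly_eq_sum[OF deg] by (simp add: cos_of_real)
  then have F_real: "cmod (F (complex_of_real t)) \<le> M" for t
    using bd[of "cos t"] by simp
  \<comment> \<open>\<open>w\<^sup>n R((w + 1/w) / 2)\<close> is a polynomial in \<open>w\<close>, bounded by \<open>M\<close> on the unit circle.\<close>
  define S where "S = (\<lambda>w. \<Sum>i\<le>n. c i * ((w\<^sup>2 + 1) / 2) ^ i * w ^ (n - i))"
  have S: "S (exp (\<i> * z)) = exp (\<i> * z) ^ n * F z" for z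
  proof -
    have "(exp (\<i> * z) ^ 2 + 1) / 2 = exp (\<i> * z) * cos z"
      by (simp add: cos_exp_eq field_simps power2_eq_square flip: exp_add)
    then show ?thesis
      unfolding S_def F sum_distrib_left
      by (intro sum.cong) (auto simp: power_mult_distrib algebra_simps simp flip: power_add)
  qed
  have S_circle: "cmod (S w) \<le> M" if "cmod w = 1" for w
  proof -
    have "w = cis (Arg w)"
      using rcis_cmod_Arg[of w] that by (simp add: rcis_def)
    then obtain t where "w = exp (\<i> * complex_of_real t)"
      by (simp add: cis_conv_exp)
    then show ?thesis using S[of "of_real t"] F_real[of t]
      by (simp add: norm_mult norm_power)
  qed
  have hol: "S holomorphic_on A" for A
    unfolding S_def by (intro holomorphic_intros) simp
  have S_disc: "cmod (S w) \<le> M" if "cmod w \<le> 1" for w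
    by (rule maximum_modulus_frontier[of S "cball 0 1"])
       (use that S_circle in \<open>auto intro!: holomorphic_on_imp_continuous_on hol\<close>)
  have upper: "cmod (F z) \<le> M * exp (real n * Im z)" if "Im z \<ge> 0" for z
  proof -
    have "cmod (exp (\<i> * z)) = exp (- Im z)" by simp
    with that have "cmod (S (exp (\<i> * z))) \<le> M" by (intro S_disc) simp
    then have "exp (- Im z) ^ n * cmod (F z) \<le> M"
      unfolding S by (simp add: norm_mult norm_power)
    then show ?thesis
      by (simp add: exp_minus field_simps power_inverse flip: exp_of_nat_mult)
  qed
  \<comment> \<open>Evenness carries the bound from the upper to the lower half-plane.\<close>
  have "F (- z) = F z" by (simp add: F_def)
  then show ?thesis
    using upper[of z] upper[of "- z"] by (cases "Im z \<ge> 0") simp_all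
qed

text \<open>Bernstein's inequality with the constant e: on a circle of radius 1 / n about a real
  point the growth factor is at most e, so Cauchy's estimate bounds the derivative on the real axis
  by e n M.\<close>

lemma cos_poly_Lipschitz:
  fixes R :: "real poly"
  assumes deg: "degree R \<le> n" and n: "n \<ge> 1"
    and bd: "\<And>v. v \<in> {-1..1} \<Longrightarrow> \<bar>poly R v\<bar> \<le> M"
  shows "\<bar>poly R (cos s) - poly R (cos t)\<bar> \<le> exp 1 * real n * M * \<bar>s - t\<bar>"
proof -
  define F where "F = (\<lambda>z. \<Sum>i\<le>n. complex_of_real (coeff R i) * cos z ^ i)"
  have M: "0 \<le> M" using bd[of 0] by auto
  have hol: "F holomorphic_on A" for A
    unfolding F_def by (intro holomorphic_intros)
  have F_of_real: "F (of_real s) = of_real (poly R (cos s))" for s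
    unfolding F_def poly_eq_sum[OF deg] by (simp add: cos_of_real)
  have deriv: "cmod (deriv F z) \<le> exp 1 * real n * M" if "z \<in> \<real>" for z
  proof -
    have "cmod ((deriv ^^ 1) F z) \<le> fact 1 * (M * exp 1) / (1 / real n) ^ 1"
    proof (rule Cauchy_inequality)
      fix w assume "cmod (z - w) = 1 / real n"
      moreover have "Im z = 0" using that complex_is_Real_iff by auto
      ultimately have "\<bar>Im w\<bar> \<le> 1 / real n" using abs_Im_le_cmod[of "z - w"] by simp
      then have "real n * \<bar>Im w\<bar> \<le> 1" using n by (simp add: field_simps)
      then have "M * exp (real n * \<bar>Im w\<bar>) \<le> M * exp 1" using M by (intro mult_left_mono) auto
      then show "cmod (F w) \<le> M * exp 1"
        unfolding F_def using cos_poly_growth[OF deg bd, of w] by linarith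
    qed (use n in \<open>auto intro!: holomorphic_on_imp_continuous_on hol\<close>)
    then show ?thesis using n by (simp add: mult_ac)
  qed
  have "cmod (F (of_real s) - F (of_real t)) \<le> exp 1 * real n * M * cmod (of_real s - of_real t)"
  proof (rule field_differentiable_bound)
    show "convex (\<real> :: complex set)" by (rule convex_Reals)
    show "(F has_field_derivative deriv F z) (at z within \<real>)" for z
      using hol[of UNIV] holomorphic_derivI[of F UNIV z] has_field_derivative_at_within by blast
  qed (auto intro: deriv)
  then show ?thesis unfolding F_of_real by (metis norm_of_real of_real_diff)
qed

text \<open>The Fejer kernel \<open>(1 - cos (n t)) / (1 - cos t)\<close> as a polynomial in \<open>cos t\<close>.\<close>
fun fejer :: "nat \<Rightarrow> real poly" where
  "fejer 0 = 0"
| "fejer (Suc 0) = 1"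
| "fejer (Suc (Suc n)) = [:0, 2:] * fejer (Suc n) - fejer n + 2"

section \<open>Bounds for the Fejer kernel and peak polynomials\<close>

lemma degree_fejer: "degree (fejer n) \<le> n"
proof (induction n rule: fejer.induct)
  case (3 n)
  have "degree ([:0, 2:] * fejer (Suc n)) \<le> 1 + Suc n"
    by (rule order_trans[OF degree_mult_le]) (use 3 in auto)
  then show ?case using 3 by (auto intro!: degree_add_le degree_diff_le)
qed auto

lemma poly_fejer_1: "poly (fejer n) 1 = (real n)\<^sup>2"
  by (induction n rule: fejer.induct) (auto simp: power2_eq_square algebra_simps)

lemma poly_fejer_cos: "(1 - cos t) * poly (fejer n) (cos t) = 1 - cos (real n * t)"
proof (induction n rule: fejer.induct)
  case (3 n)
  have "cos (real (Suc (Suc n)) * t) + cos (real n * t) = 2 * cos t * cos (real (Suc n) * t)"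
    using cos_add[of "real (Suc n) * t" t] cos_diff[of "real (Suc n) * t" t]
    by (simp add: algebra_simps)
  then have C: "cos (real (Suc (Suc n)) * t) = 2 * cos t * cos (real (Suc n) * t) - cos (real n * t)"
    by linarith
  \<comment> \<open>The summand 2 in the recursion, multiplied by 1 - cos t, makes up for the
    constants that appear when the three-term recursion for cos (n t) is rewritten for 1 - cos (n
    t).\<close>
  have "(1 - cos t) * poly (fejer (Suc (Suc n))) (cos t) =
      2 * cos t * ((1 - cos t) * poly (fejer (Suc n)) (cos t))
      - (1 - cos t) * poly (fejer n) (cos t) + 2 * (1 - cos t)"
    by (simp add: algebra_simps)
  also have "\<dots> = 1 - cos (real (Suc (Suc n)) * t)"
    unfolding 3 C by algebra
  finally show ?case .
qed auto

lemma abs_sin_mult_le: "\<bar>sin (real n * x)\<bar> \<le> real n * \<bar>sin x\<bar>"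
proof (induction n)
  case (Suc n)
  have "\<bar>sin (real (Suc n) * x)\<bar> \<le> \<bar>sin (real n * x)\<bar> * \<bar>cos x\<bar> + \<bar>cos (real n * x)\<bar> * \<bar>sin x\<bar>"
    by (simp add: algebra_simps sin_add flip: abs_mult)
  also have "\<dots> \<le> \<bar>sin (real n * x)\<bar> * 1 + 1 * \<bar>sin x\<bar>"
    by (intro add_mono mult_left_mono mult_right_mono) auto
  finally show ?case using Suc by (simp add: algebra_simps)
qed auto

lemma one_minus_cos: "1 - cos t = 2 * (sin (t / 2))\<^sup>2" for t :: real
  using cos_double_sin[of "t / 2"] by simp

text \<open>All three bounds are read off the quotient of 1 - cos (n t) by 1 - cos t: the numerator
  lies in [0, 2] and is at most \<open>n\<^sup>2\<close> times the denominator, by the bound on sin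
  (n t / 2). At v = 1 the quotient degenerates and the exact value is used.\<close>

lemma poly_fejer_bounds:
  assumes v: "v \<in> {-1..1}"
  shows "0 \<le> poly (fejer n) v" "poly (fejer n) v \<le> (real n)\<^sup>2" "(1 - v) * poly (fejer n) v \<le> 2"
proof -
  define t where "t = arccos v"
  have vt: "v = cos t" using v by (simp add: t_def)
  have eq: "(1 - v) * poly (fejer n) v = 1 - cos (real n * t)"
    using poly_fejer_cos[of t n] vt by simp
  show "(1 - v) * poly (fejer n) v \<le> 2" unfolding eq by (simp add: minus_le_iff)
  have le: "1 - cos (real n * t) \<le> (real n)\<^sup>2 * (1 - v)"
    unfolding vt one_minus_cos
    using power_mono[OF abs_sin_mult_le[of n "t / 2"], of 2] by (simp add: power_mult_distrib)
  have "0 \<le> poly (fejer n) v \<and> poly (fejer n) v \<le> (real n)\<^sup>2"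
  proof (cases "v = 1")
    case False
    then have "0 < 1 - v" using v by auto
    moreover have "0 \<le> (1 - v) * poly (fejer n) v" unfolding eq by simp
    moreover have "(1 - v) * poly (fejer n) v \<le> (1 - v) * (real n)\<^sup>2"
      unfolding eq using le by (simp add: mult.commute)
    ultimately show ?thesis by (simp add: zero_le_mult_iff)
  qed (simp add: poly_fejer_1)
  then show "0 \<le> poly (fejer n) v" "poly (fejer n) v \<le> (real n)\<^sup>2" by auto
qed

text \<open>The Fejer kernel normalised to 1 at the endpoint is at most 1, and its product with
  \<open>n\<^sup>2 (1 - v)\<close> is at most 2; adding these gives the constant 3. The m-th power
  makes the decay on the scale \<open>n\<^sup>-\<^sup>2\<close> as fast as desired.\<close>

lemma peak_polynomial:
  assumes n: "n \<ge> 1"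
  obtains Q :: "real poly" where "degree Q \<le> n * m" "poly Q 1 = 1"
    "\<And>v. v \<in> {-1..1} \<Longrightarrow> \<bar>poly Q v\<bar> \<le> (3 / (1 + (real n)\<^sup>2 * (1 - v))) ^ m"
proof
  define q where "q = smult (1 / (real n)\<^sup>2) (fejer n)"
  show "degree (q ^ m) \<le> n * m"
    using degree_power_le[of q m] degree_fejer[of n] n
    by (auto simp: q_def intro: order_trans mult_right_mono)
  show "poly (q ^ m) 1 = 1" using n by (simp add: q_def poly_fejer_1)
  fix v :: real assume v: "v \<in> {-1..1}"
  have q: "0 \<le> poly q v" "poly q v \<le> 1" "(real n)\<^sup>2 * (1 - v) * poly q v \<le> 2"
    using poly_fejer_bounds[OF v, of n] n by (simp_all add: q_def)
  have "0 < 1 + (real n)\<^sup>2 * (1 - v)" using v by (intro add_pos_nonneg mult_nonneg_nonneg) auto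
  moreover have "poly q v * (1 + (real n)\<^sup>2 * (1 - v)) \<le> 3" using q by (simp add: algebra_simps)
  ultimately have "poly q v \<le> 3 / (1 + (real n)\<^sup>2 * (1 - v))" by (simp add: field_simps)
  then show "\<bar>poly (q ^ m) v\<bar> \<le> (3 / (1 + (real n)\<^sup>2 * (1 - v))) ^ m"
    using q by (simp add: power_abs power_mono)
qed

lemma sin_ge_half: "0 \<le> x \<Longrightarrow> x \<le> 1 \<Longrightarrow> x / 2 \<le> sin x" for x :: real
proof -
  assume x: "0 \<le> x" "x \<le> 1"
  have "\<bar>sin x - (\<Sum>m<3. sin_coeff m * x ^ m)\<bar> \<le> inverse (fact 3) * \<bar>x\<bar> ^ 3"
    by (rule Maclaurin_sin_bound)
  then have "\<bar>sin x - x\<bar> \<le> x ^ 3 / 6"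
    using x by (simp add: sin_coeff_def eval_nat_numeral)
  moreover have "x ^ 3 \<le> x" using power_decreasing[of 1 3 x] x by simp
  ultimately show ?thesis by linarith
qed

text \<open>In the variable t = arccos v, Bernstein's inequality keeps the modulus of R above half
  its maximum on an interval of length of order 1 / n at the maximum point. The cosine shortens such
  an interval most near 0 and pi, to order \<open>n\<^sup>-\<^sup>2\<close>.\<close>

lemma polynomial_large_near_max:
  fixes R :: "real poly"
  assumes deg: "degree R \<le> n" and n: "n \<ge> 1"
  obtains a b where "-1 \<le> a" "b \<le> 1" "b - a \<ge> 1 / (288 * (real n)\<^sup>2)"
    "\<forall>v\<in>{a..b}. \<forall>w\<in>{-1..1}. \<bar>poly R w\<bar> \<le> 2 * \<bar>poly R v\<bar>"
proof -
  have "continuous_on {-1..1} (\<lambda>v. \<bar>poly R v\<bar>)" by (intro continuous_intros)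
  then obtain v0 where v0: "v0 \<in> {-1..1}" and max: "\<And>w. w \<in> {-1..1} \<Longrightarrow> \<bar>poly R w\<bar> \<le> \<bar>poly R v0\<bar>"
    using continuous_attains_sup[of "{-1..1::real}" "\<lambda>v. \<bar>poly R v\<bar>"] by auto
  define M where "M = \<bar>poly R v0\<bar>"
  define t0 where "t0 = arccos v0"
  have t0: "0 \<le> t0" "t0 \<le> pi" "cos t0 = v0"
    using v0 by (auto simp: t0_def arccos_lbound arccos_ubound)
  \<comment> \<open>Since e is at most 3, R (cos t) varies by at most 3 n M r = M / 2 over a
    distance r.\<close>
  define r where "r = 1 / (6 * real n)"
  have r: "0 < r" "r \<le> 1 / 6" using n by (auto simp: r_def field_simps)
  \<comment> \<open>The interval runs from \<open>t0\<close> towards pi / 2 and therefore stays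
    inside [0, pi].\<close>
  define l where "l = (if t0 \<le> pi / 2 then t0 else t0 - r)"
  have l: "0 \<le> l" "l + r \<le> pi" "l \<le> t0" "t0 \<le> l + r"
    using t0 r pi_gt3 by (auto simp: l_def)
  have s: "r / 4 \<le> sin (r / 2)" using sin_ge_half[of "r / 2"] r by simp
  have s': "sin (r / 2) \<le> sin (l + r / 2)"
  proof (cases "l + r / 2 \<le> pi / 2")
    case True
    then show ?thesis using l r by (intro sin_monotone_2pi_le) auto
  next
    case False
    then have "sin (r / 2) \<le> sin (pi - (l + r / 2))"
      using l r by (intro sin_monotone_2pi_le) auto
    then show ?thesis by (simp only: sin_pi_minus)
  qed
  \<comment> \<open>Both sines are at least r / 4, so the image has length at least
    \<open>r\<^sup>2 / 8\<close>, which is where 288 comes from.\<close>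
  have "cos l - cos (l + r) = 2 * sin (l + r / 2) * sin (r / 2)"
    by (simp add: cos_diff_cos add_divide_distrib)
  also have "\<dots> \<ge> 2 * (r / 4) * (r / 4)"
    using s s' r by (intro mult_mono) auto
  also have "2 * (r / 4) * (r / 4) = 1 / (288 * (real n)\<^sup>2)"
    by (simp add: r_def power2_eq_square)
  finally have len: "cos l - cos (l + r) \<ge> 1 / (288 * (real n)\<^sup>2)" .
  show thesis
  proof (rule that[of "cos (l + r)" "cos l"]; (intro ballI)?)
    fix v w :: real assume v: "v \<in> {cos (l + r)..cos l}" and w: "w \<in> {-1..1}"
    define t where "t = arccos v"
    have v1: "-1 \<le> v" "v \<le> 1" using v cos_ge_minus_one[of "l + r"] cos_le_one[of l] unfolding atLeastAtMost_iff by linarith+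
    have vt: "v = cos t" using v1 by (simp add: t_def)
    have "arccos (cos l) \<le> t" "t \<le> arccos (cos (l + r))"
      unfolding t_def using v v1 by (auto intro!: arccos_le_arccos)
    then have "l \<le> t" "t \<le> l + r" using l r by (auto simp: arccos_cos)
    then have tt: "\<bar>t0 - t\<bar> \<le> r" using l by auto
    have "\<bar>poly R (cos t0) - poly R (cos t)\<bar> \<le> exp 1 * real n * M * \<bar>t0 - t\<bar>"
      unfolding M_def by (rule cos_poly_Lipschitz[OF deg n max])
    also have "\<dots> \<le> 3 * real n * M * r"
      using tt exp_le by (intro mult_mono) (auto simp: M_def)
    also have "\<dots> = M / 2" using n by (simp add: r_def)
    finally have "M \<le> 2 * \<bar>poly R v\<bar>" unfolding vt t0(3) M_def by linarith
    then show "\<bar>poly R w\<bar> \<le> 2 * \<bar>poly R v\<bar>" using max[OF w] by (simp add: M_def)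
  qed (use len in auto)
qed

section \<open>Equal cells and the one-sided local estimate\<close>

text \<open>The cells have length 2 / N and are half-open, which makes them disjoint; together they
  cover [-1, 1] except for the point -1.\<close>

definition cell :: "nat \<Rightarrow> nat \<Rightarrow> real set" where
  "cell N j = {-1 + 2 * real j / real N <.. -1 + 2 * (real j + 1) / real N}"

lemma cell_subset:
  assumes "j < N" shows "cell N j \<subseteq> {-1<..1}"
proof -
  have "2 * (real j + 1) / real N \<le> 2" using assms by (simp add: field_simps)
  moreover have "2 * real j / real N \<ge> 0" by simp
  ultimately have "-1 < y \<and> y \<le> 1" if "y \<in> cell N j" for y
    using that unfolding cell_def greaterThanAtMost_iff by linarith
  then show ?thesis by auto
qed

text \<open>The length 4 / N is that of two cells: less than one is lost between a and the next grid
  point, and a whole cell still fits after it.\<close>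

lemma interval_contains_cell:
  assumes N: "N \<ge> 1" and ab: "-1 \<le> a" "b \<le> 1" "b - a \<ge> 4 / real N"
  obtains j where "j < N" "cell N j \<subseteq> {a..b}"
proof -
  define j where "j = nat \<lceil>(a + 1) * real N / 2\<rceil>"
  have "0 \<le> (a + 1) * real N / 2" using ab by simp
  then have "0 \<le> \<lceil>(a + 1) * real N / 2\<rceil>" by (metis ceiling_mono ceiling_zero)
  then have "real j = of_int \<lceil>(a + 1) * real N / 2\<rceil>"
    unfolding j_def by (rule of_nat_nat)
  then have j: "(a + 1) * real N / 2 \<le> real j" "real j < (a + 1) * real N / 2 + 1"
    using ceiling_correct[of "(a + 1) * real N / 2"] by auto
  have lo: "a \<le> -1 + 2 * real j / real N" using j N by (simp add: field_simps)
  have "2 * (real j + 1) \<le> (a + 1) * real N + 4" using j by (simp add: field_simps)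
  also have "\<dots> \<le> (b + 1) * real N" using ab N by (simp add: field_simps)
  finally have hi: "-1 + 2 * (real j + 1) / real N \<le> b" using N by (simp add: field_simps)
  have "2 * (real j + 1) / real N \<le> 2" using hi ab by linarith
  then have "j < N" using N by (simp add: field_simps)
  moreover have "cell N j \<subseteq> {a..b}" using lo hi by (auto simp: cell_def)
  ultimately show thesis using that by blast
qed

text \<open>Distinct cells j and k are separated by |j - k| - 1 whole cells. For j = k the left-hand
  side is negative.\<close>

lemma cell_dist:
  assumes "N \<ge> 1" "x \<in> cell N k" "y \<in> cell N j"
  shows "(\<bar>real j - real k\<bar> - 1) * 2 / real N \<le> \<bar>y - x\<bar>"
proof -
  define X Y where "X = real N * (x + 1)" and "Y = real N * (y + 1)"
  have "2 * real k < X" "X \<le> 2 * real k + 2" "2 * real j < Y" "Y \<le> 2 * real j + 2"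
    using assms by (auto simp: cell_def field_simps X_def Y_def)
  then have "(\<bar>real j - real k\<bar> - 1) * 2 \<le> \<bar>Y - X\<bar>" by (smt (verit))
  also have "\<dots> = real N * \<bar>y - x\<bar>"
    by (simp add: X_def Y_def abs_mult flip: right_diff_distrib)
  finally show ?thesis using assms(1) by (simp add: field_simps)
qed

text \<open>
  Multiply \<open>P\<close> by a polynomial of degree \<open>n m\<close> that peaks at the endpoint \<open>x\<close> of the segment from
  \<open>x\<close> to \<open>x + \<sigma> \<delta>\<close>. The product is large on a set that contains a whole cell, and the
  decay of the peak gives the factor in the distance of the cells.
\<close>
lemma one_sided_local_bound:
  fixes \<delta> :: real and m :: nat
  assumes \<delta>: "0 < \<delta>"
  obtains K :: nat and C :: real where "K \<ge> 1" "C > 0"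
    "\<And>n (P :: real poly) k x \<sigma>. \<lbrakk>n \<ge> 1; degree P \<le> n; k < K * n\<^sup>2; x \<in> cell (K * n\<^sup>2) k; \<bar>\<sigma>\<bar> = 1;
        x + \<sigma> * \<delta> \<in> {-1..1}\<rbrakk> \<Longrightarrow>
      \<exists>j<K * n\<^sup>2. \<forall>y\<in>cell (K * n\<^sup>2) j. 0 \<le> \<sigma> * (y - x) \<and> \<sigma> * (y - x) \<le> \<delta> \<and>
        \<bar>poly P x\<bar> \<le> C * (1 / (1 + \<bar>real j - real k\<bar>)) ^ m * \<bar>poly P y\<bar>"
proof -
  \<comment> \<open>The product R below has degree at most n (m + 1), so it is large on an interval
    of length at least \<open>1 / (288 n\<^sup>2 (m + 1)\<^sup>2)\<close>. Scaled by
    \<open>\<delta> / 2\<close>, this must be at least 4 / N with \<open>N = K n\<^sup>2\<close>;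
    hence 2304 = 8 * 288.\<close>
  define K where "K = nat \<lceil>2304 * (real m + 1)\<^sup>2 / \<delta>\<rceil>"
  have Kpos: "0 < 2304 * (real m + 1)\<^sup>2 / \<delta>" using \<delta> by (intro divide_pos_pos mult_pos_pos) auto
  have K: "2304 * (real m + 1)\<^sup>2 / \<delta> \<le> real K" unfolding K_def by (rule real_nat_ceiling_ge)
  have K1: "K \<ge> 1" using K Kpos by (cases K) auto
  \<comment> \<open>A cell has length \<open>4 / (\<delta> N)\<close> in the variable v of the peak,
    and \<open>a\<close> is \<open>n\<^sup>2\<close> times that. The choice of \<open>c\<close>
    ensures c (1 + d) <= 1 + a (d - 1) for d >= 1, and c <= 1 for d = 0.\<close>
  define a where "a = 4 / (\<delta> * real K)"
  define c where "c = min a 1 / 2"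
  have a: "0 < a" unfolding a_def using \<delta> K1 by simp
  have c: "0 < c" using a by (auto simp: c_def)
  define C where "C = 2 * (3 / c) ^ m"
  have C: "C > 0" using c by (simp add: C_def)
  show thesis
  proof (rule that[OF K1 C])
    fix n k :: nat and P :: "real poly" and x \<sigma> :: real
    assume n: "n \<ge> (1::nat)" and deg: "degree P \<le> n" and k: "k < K * n\<^sup>2"
      and x: "x \<in> cell (K * n\<^sup>2) k" and \<sigma>: "\<bar>\<sigma>\<bar> = 1" and x\<sigma>: "x + \<sigma> * \<delta> \<in> {-1..1}"
    define N where "N = K * n\<^sup>2"
    have N1: "N \<ge> 1" using K1 n by (simp add: N_def)
    have \<sigma>\<sigma>: "\<sigma> * \<sigma> = 1" using \<sigma> by (metis abs_mult_self_eq mult_1)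
    have x1: "x \<in> {-1..1}" using cell_subset[OF k] x by auto
    \<comment> \<open>This affine map takes [-1, 1] onto the segment from x to
      \<open>x + \<sigma> * \<delta>\<close> and 1 to x, so the peak of Q is placed at x.\<close>
    define \<phi> where "\<phi> = (\<lambda>v. x + \<sigma> * \<delta> / 2 * (1 - v))"
    obtain Q :: "real poly" where Q: "degree Q \<le> n * m" "poly Q 1 = 1"
      "\<And>v. v \<in> {-1..1} \<Longrightarrow> \<bar>poly Q v\<bar> \<le> (3 / (1 + (real n)\<^sup>2 * (1 - v))) ^ m"
      using peak_polynomial[OF n] by metis
    define R where "R = pcompose P [: x + \<sigma> * \<delta> / 2, - (\<sigma> * \<delta> / 2) :] * Q"
    have "poly [: x + \<sigma> * \<delta> / 2, - (\<sigma> * \<delta> / 2) :] v = \<phi> v" for v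
      by (simp add: \<phi>_def diff_divide_distrib right_diff_distrib mult_ac)
    then have R: "poly R v = poly P (\<phi> v) * poly Q v" for v
      unfolding R_def poly_mult poly_pcompose by simp
    have "degree R \<le> degree P * degree [: x + \<sigma> * \<delta> / 2, - (\<sigma> * \<delta> / 2) :] + degree Q"
      unfolding R_def by (rule order_trans[OF degree_mult_le]) (simp add: degree_pcompose)
    also have "\<dots> \<le> n * 1 + n * m"
      using deg Q(1) by (intro add_mono mult_mono) auto
    finally have degR: "degree R \<le> n * (m + 1)" by simp
    have nm: "1 \<le> n * (m + 1)" using n by (cases n) auto
    obtain p q where pq: "-1 \<le> p" "q \<le> 1" "q - p \<ge> 1 / (288 * (real (n * (m + 1)))\<^sup>2)"
      and big: "\<forall>v\<in>{p..q}. \<forall>w\<in>{-1..1}. \<bar>poly R w\<bar> \<le> 2 * \<bar>poly R v\<bar>"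
      by (rule polynomial_large_near_max[OF degR nm])
    have len: "\<delta> / 2 * (q - p) \<ge> 4 / real N"
    proof -
      define Y where "Y = (real (n * (m + 1)))\<^sup>2"
      have "0 < n * (m + 1)" using nm by linarith
      then have Y: "0 < Y" by (simp only: Y_def zero_less_power of_nat_0_less_iff)
      have "2304 * (real m + 1)\<^sup>2 * (real n)\<^sup>2 \<le> (\<delta> * real K) * (real n)\<^sup>2"
        using K \<delta> by (intro mult_right_mono) (auto simp: field_simps)
      then have "2304 * Y \<le> \<delta> * real N"
        by (simp only: Y_def N_def of_nat_mult of_nat_add of_nat_power power_mult_distrib of_nat_1 mult_ac)
      then have "4 / real N \<le> \<delta> / 2 * (1 / (288 * Y))"
        using Y N1 by (simp add: field_simps)
      also have "\<dots> \<le> \<delta> / 2 * (q - p)"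
        unfolding Y_def using pq(3) \<delta> by (intro mult_left_mono) auto
      finally show ?thesis .
    qed
    \<comment> \<open>The map \<open>\<phi>\<close> reverses the order for
      \<open>\<sigma> = 1\<close> and preserves it for \<open>\<sigma> = -1\<close>.\<close>
    define lo where "lo = min (\<phi> p) (\<phi> q)"
    define hi where "hi = max (\<phi> p) (\<phi> q)"
    have pq': "p \<le> q" using pq(3) by (smt (verit) zero_le_divide_1_iff zero_le_mult_iff zero_le_power2)
    have \<sigma>_cases: "\<sigma> = 1 \<or> \<sigma> = -1" using \<sigma> by auto
    have \<phi>_range: "\<phi> v \<in> {-1..1}" if "-1 \<le> v" "v \<le> 1" for v
    proof -
      have "\<phi> v = (1 - (1 - v) / 2) * x + (1 - v) / 2 * (x + \<sigma> * \<delta>)"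
        by (simp add: \<phi>_def field_simps)
      moreover have "convex {-1..1::real}" by simp
      ultimately show ?thesis
        using convexD[OF \<open>convex {-1..1::real}\<close> x1 x\<sigma>, of "1 - (1 - v) / 2" "(1 - v) / 2"] that
        by simp
    qed
    have "-1 \<le> lo" "hi \<le> 1"
      using \<phi>_range[of p] \<phi>_range[of q] pq pq' by (auto simp: lo_def hi_def)
    moreover have "hi - lo = \<delta> / 2 * (q - p)"
    proof -
      have "\<phi> p - \<phi> q = \<sigma> * (\<delta> / 2 * (q - p))"
        by (simp add: \<phi>_def diff_divide_distrib right_diff_distrib mult_ac)
      then have "\<bar>\<phi> p - \<phi> q\<bar> = \<bar>\<sigma>\<bar> * \<bar>\<delta> / 2 * (q - p)\<bar>" by (simp only: abs_mult)
      moreover have "hi - lo = \<bar>\<phi> p - \<phi> q\<bar>" by (simp add: hi_def lo_def)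
      ultimately show ?thesis using \<sigma> \<delta> pq' by simp
    qed
    ultimately obtain j where j: "j < N" "cell N j \<subseteq> {lo..hi}"
      using interval_contains_cell[OF N1, of lo hi] len by auto
    show "\<exists>j<K * n\<^sup>2. \<forall>y\<in>cell (K * n\<^sup>2) j. 0 \<le> \<sigma> * (y - x) \<and> \<sigma> * (y - x) \<le> \<delta> \<and>
        \<bar>poly P x\<bar> \<le> C * (1 / (1 + \<bar>real j - real k\<bar>)) ^ m * \<bar>poly P y\<bar>"
      unfolding N_def[symmetric]
    proof (intro exI[of _ j] conjI ballI)
      fix y assume y: "y \<in> cell N j"
      define v where "v = 1 - 2 * \<sigma> * (y - x) / \<delta>"
      have "\<phi> v = x + (\<sigma> * \<sigma>) * (y - x)" using \<delta> by (simp add: \<phi>_def v_def)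
      then have \<phi>v: "\<phi> v = y" by (simp add: \<sigma>\<sigma>)
      have ylohi: "lo \<le> y" "y \<le> hi" using j y by auto
      have "p \<le> v \<and> v \<le> q"
        using ylohi \<delta> \<sigma>_cases pq' unfolding lo_def hi_def \<phi>_def v_def
        by (auto simp: field_simps min_def max_def split: if_splits)
      then have v: "v \<in> {p..q}" "v \<in> {-1..1}" using pq by auto
      have v': "1 - v = 2 * (\<sigma> * (y - x)) / \<delta>" by (simp add: v_def)
      then have "\<sigma> * (y - x) = (1 - v) / 2 * \<delta>" using \<delta> by (simp add: field_simps)
      moreover have "0 \<le> (1 - v) / 2 * \<delta>" "(1 - v) / 2 * \<delta> \<le> 1 * \<delta>"
        using v(2) \<delta> by (auto intro!: mult_right_mono)
      ultimately show y1: "0 \<le> \<sigma> * (y - x)" "\<sigma> * (y - x) \<le> \<delta>" by auto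
      have yx: "\<sigma> * (y - x) = \<bar>y - x\<bar>" using y1 \<sigma>_cases by auto
      define d where "d = \<bar>real j - real k\<bar>"
      have d: "d = 0 \<or> d \<ge> 1" unfolding d_def by (cases "j = k") auto
      have "a * (d - 1) = (real n)\<^sup>2 * (2 * ((d - 1) * 2 / real N) / \<delta>)"
        using n K1 by (simp add: a_def N_def)
      also have "\<dots> \<le> (real n)\<^sup>2 * (2 * \<bar>y - x\<bar> / \<delta>)"
        using cell_dist[OF N1 x[folded N_def] y] \<delta> unfolding d_def
        by (intro mult_left_mono divide_right_mono) auto
      finally have ad: "a * (d - 1) \<le> (real n)\<^sup>2 * (1 - v)" unfolding v' yx .
      have nv: "0 \<le> (real n)\<^sup>2 * (1 - v)" using v by (intro mult_nonneg_nonneg) auto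
      have "c * (1 + d) \<le> 1 + (real n)\<^sup>2 * (1 - v)"
      proof (cases "d = 0")
        case True
        then show ?thesis using nv by (simp add: c_def)
      next
        case False
        then have d1: "d \<ge> 1" using d by simp
        have "c * (1 + d) \<le> c * (2 * d)" using c d1 by (intro mult_left_mono) auto
        also have "\<dots> = min a 1 * d" by (simp add: c_def)
        also have "\<dots> = min a 1 + min a 1 * (d - 1)" by (simp add: algebra_simps)
        also have "\<dots> \<le> 1 + a * (d - 1)" using d1 by (intro add_mono mult_right_mono) auto
        finally show ?thesis using ad by linarith
      qed
      moreover have pos: "0 < 1 + (real n)\<^sup>2 * (1 - v)" using nv by linarith
      moreover have d0: "0 \<le> d" by (simp add: d_def)
      ultimately have "3 / (1 + (real n)\<^sup>2 * (1 - v)) \<le> 3 / (c * (1 + d))"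
        using c pos by (intro divide_left_mono mult_pos_pos) auto
      then have "(3 / (1 + (real n)\<^sup>2 * (1 - v))) ^ m \<le> (3 / (c * (1 + d))) ^ m"
        using nv by (intro power_mono) auto
      then have Qv: "\<bar>poly Q v\<bar> \<le> (3 / c) ^ m * (1 / (1 + d)) ^ m"
        using Q(3)[OF v(2)] by (simp add: power_mult_distrib[symmetric])
      \<comment> \<open>Because Q is 1 at its peak, P x is the value of R at 1, which the values of
        R on [p, q] dominate up to the factor 2.\<close>
      have "\<phi> 1 = x" by (simp add: \<phi>_def)
      then have "\<bar>poly P x\<bar> = \<bar>poly R 1\<bar>" by (simp add: R Q)
      also have "\<dots> \<le> 2 * \<bar>poly R v\<bar>" using big v(1) by auto
      also have "\<dots> = 2 * (\<bar>poly P y\<bar> * \<bar>poly Q v\<bar>)" by (simp add: R \<phi>v abs_mult)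
      also have "\<dots> \<le> 2 * (\<bar>poly P y\<bar> * ((3 / c) ^ m * (1 / (1 + d)) ^ m))"
        using Qv by (intro mult_left_mono) auto
      also have "\<dots> = C * (1 / (1 + d)) ^ m * \<bar>poly P y\<bar>" by (simp add: C_def)
      finally show "\<bar>poly P x\<bar> \<le> C * (1 / (1 + \<bar>real j - real k\<bar>)) ^ m * \<bar>poly P y\<bar>"
        unfolding d_def .
    qed (rule j)
  qed
qed

section \<open>Weights increasing away from their zeros\<close>

text \<open>The constant \<open>c\<close> absorbs the factors of a product that do not vanish at \<open>y\<close>.\<close>
definition increasing_outward :: "real set \<Rightarrow> (real \<Rightarrow> real) \<Rightarrow> real \<Rightarrow> bool" where
  "increasing_outward S w y \<longleftrightarrow> (\<exists>\<epsilon>>0. \<exists>c>0. \<forall>a\<in>S. \<forall>b\<in>S.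
     y \<le> a \<and> a \<le> b \<and> b \<le> y + \<epsilon> \<or> y - \<epsilon> \<le> b \<and> b \<le> a \<and> a \<le> y \<longrightarrow> c * w a \<le> w b)"

section \<open>Behaviour of the weights in \<open>Omega\<close>\<close>

text \<open>As F is even and decreasing, w is an increasing function of |g|. At a zero of g, which
  is simple, |g| grows on both sides; elsewhere w is locally bounded below by a positive constant,
  and it never exceeds 1. Continuity at the zeros of g is the divergence of F at 0.\<close>

lemma Omega_properties:
  assumes "w \<in> Omega"
  shows "continuous_on UNIV w" "0 \<le> w t" "increasing_outward UNIV w t"
proof -
  obtain A g F where A: "A > 0" and g: "Omega_inner A g" and F: "Omega_outer A F"
    and w: "w = (\<lambda>t. if g t = 0 then 0 else exp (- F (g t)))"
    using assms unfolding Omega_def by auto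
  obtain d where d: "derivatives_on UNIV g d" and simple: "\<And>t. g t = 0 \<Longrightarrow> d 1 t \<noteq> 0"
    using g unfolding Omega_inner_def by auto
  have gA: "\<bar>g t\<bar> \<le> A" for t using g unfolding Omega_inner_def by (auto simp: abs_le_iff minus_le_iff)
  have d0: "d 0 = g" using d by (auto simp: derivatives_on_def)
  have dn: "(d n has_real_derivative d (Suc n) t) (at t)" for n t
    using d by (auto simp: derivatives_on_def)
  have g_deriv: "(g has_real_derivative d 1 t) (at t)" for t using dn[of 0 t] by (simp add: d0)
  have g_cont: "isCont g t" for t using g_deriv by (rule DERIV_isCont)
  have F_pos: "F x > 0" and F_even: "F (- x) = F x" if "\<bar>x\<bar> \<le> A" "x \<noteq> 0" for x
    using F that unfolding Omega_outer_def by (auto simp: abs_le_iff)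
  have F_anti: "F y \<le> F x" if "0 < x" "x \<le> y" "y \<le> A" for x y
    using F that by (auto simp: Omega_outer_def intro: monotone_onD)
  have F_abs: "F \<bar>x\<bar> = F x" if "\<bar>x\<bar> \<le> A" "x \<noteq> 0" for x
    using F_even[of x] that by (cases "x < 0") auto
  have w_abs: "w t = (if g t = 0 then 0 else exp (- F \<bar>g t\<bar>))" for t
    using F_abs gA by (simp add: w)
  show w_nonneg: "0 \<le> w t" for t by (simp add: w)
  have w_le_1: "w t \<le> 1" for t using F_pos[OF gA, of t] by (auto simp: w less_imp_le)
  have w_mono: "w a \<le> w b" if "\<bar>g a\<bar> \<le> \<bar>g b\<bar>" for a b
  proof (cases "g a = 0")
    case False
    then have "F \<bar>g b\<bar> \<le> F \<bar>g a\<bar>" using that gA by (intro F_anti) auto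
    then show ?thesis using False that by (auto simp: w_abs)
  qed (simp add: w)
  have F_cont: "continuous_on {0<..A} F"
  proof -
    obtain dF where "derivatives_on {0<..A} F dF" using F unfolding Omega_outer_def by auto
    then have "(dF 0 has_real_derivative dF 1 x) (at x within {0<..A})" "dF 0 x = F x"
      if "x \<in> {0<..A}" for x
      using that by (auto simp: derivatives_on_def)
    then have "continuous_on {0<..A} (dF 0)" "\<And>x. x \<in> {0<..A} \<Longrightarrow> dF 0 x = F x"
      by (auto intro!: DERIV_continuous_on[where D = "dF 1"])
    then show ?thesis by (metis (no_types, lifting) continuous_on_cong)
  qed
  have "isCont w t" for t
  proof (cases "g t = 0")
    case False
    define U where "U = {t. g t \<noteq> 0}"
    have cg: "continuous_on S g" for S using g_cont by (auto intro: continuous_at_imp_continuous_on)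
    have "open U" unfolding U_def using cg by (intro open_Collect_neq) auto
    have "continuous_on U (\<lambda>t. exp (- F \<bar>g t\<bar>))"
      by (intro continuous_intros continuous_on_compose2[OF F_cont] cg) (use gA in \<open>auto simp: U_def\<close>)
    moreover have "exp (- F \<bar>g t\<bar>) = w t" if "t \<in> U" for t using that by (simp add: w_abs U_def)
    ultimately have "continuous_on U w" by (metis (no_types, lifting) continuous_on_cong)
    then show ?thesis using \<open>open U\<close> False by (auto simp: continuous_on_eq_continuous_at U_def)
  next
    case True
    have "(w \<longlongrightarrow> 0) (at t)"
    proof (rule tendstoI)
      fix e :: real assume e: "e > 0"
      have "filterlim F at_top (at_right 0)" using F by (simp add: Omega_outer_def)
      then have "eventually (\<lambda>x. F x > - ln e) (at_right 0)" by (simp add: filterlim_at_top_dense)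
      then obtain \<eta> where \<eta>: "\<eta> > 0" "\<And>x. 0 < x \<Longrightarrow> x < \<eta> \<Longrightarrow> F x > - ln e"
        unfolding eventually_at_right_field by auto
      have "(g \<longlongrightarrow> 0) (at t)" using g_cont[of t] True by (simp add: isCont_def)
      then have "eventually (\<lambda>s. \<bar>g s\<bar> < \<eta>) (at t)" using \<eta>(1) tendstoD by fastforce
      then show "eventually (\<lambda>s. dist (w s) 0 < e) (at t)"
      proof eventually_elim
        case (elim s)
        show ?case
        proof (cases "g s = 0")
          case False
          then have "- F \<bar>g s\<bar> < ln e" using \<eta>(2)[of "\<bar>g s\<bar>"] elim by auto
          then have "exp (- F \<bar>g s\<bar>) < e" using e by (metis exp_less_mono exp_ln)
          then show ?thesis using False by (simp add: w_abs)
        qed (simp add: w e)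
      qed
    qed
    then show ?thesis using True by (simp add: isCont_def w)
  qed
  then show "continuous_on UNIV w" by (auto intro: continuous_at_imp_continuous_on)
  show "increasing_outward UNIV w t"
  proof (cases "g t = 0")
    case False
    define \<mu> where "\<mu> = \<bar>g t\<bar> / 2"
    have \<mu>: "0 < \<mu>" using False by (simp add: \<mu>_def)
    obtain \<epsilon> where \<epsilon>: "\<epsilon> > 0" "\<And>s. \<bar>s - t\<bar> < \<epsilon> \<Longrightarrow> \<bar>g s - g t\<bar> < \<mu>"
      using g_cont[of t] \<mu> unfolding continuous_at_real_range real_norm_def by metis
    define c where "c = exp (- F \<mu>)"
    have "c * w a \<le> w b" if "\<bar>b - t\<bar> \<le> \<epsilon> / 2" for a b
    proof -
      have "\<bar>g b\<bar> \<ge> \<mu>" using \<epsilon>(2)[of b] that \<epsilon>(1) unfolding \<mu>_def by linarith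
      then have "F \<bar>g b\<bar> \<le> F \<mu>" "g b \<noteq> 0" using \<mu> gA by (auto intro: F_anti)
      then have "c \<le> w b" by (simp add: w_abs c_def)
      moreover have "c * w a \<le> c * 1" using w_le_1 by (intro mult_left_mono) (auto simp: c_def)
      ultimately show ?thesis by simp
    qed
    then show ?thesis unfolding increasing_outward_def
      by (intro exI[of _ "\<epsilon> / 2"] exI[of _ c] conjI) (use \<epsilon>(1) in \<open>auto simp: c_def\<close>)
  next
    case True
    \<comment> \<open>Multiplying g by the sign of its derivative at t makes it nondecreasing near
      t; as it vanishes at t, its modulus grows in both directions.\<close>
    define \<sigma> where "\<sigma> = sgn (d 1 t)"
    have \<sigma>: "\<bar>\<sigma>\<bar> = 1" using simple[OF True] by (simp add: \<sigma>_def abs_sgn_eq)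
    have "isCont (d 1) t" using dn[of 1 t] by (auto intro: DERIV_isCont)
    then obtain \<epsilon> where \<epsilon>: "\<epsilon> > 0" "\<And>s. \<bar>s - t\<bar> < \<epsilon> \<Longrightarrow> \<bar>d 1 s - d 1 t\<bar> < \<bar>d 1 t\<bar>"
      using simple[OF True] unfolding continuous_at_real_range real_norm_def by (metis zero_less_abs_iff)
    have mono: "\<sigma> * g a \<le> \<sigma> * g b" if "a \<le> b" "t - \<epsilon> / 2 \<le> a" "b \<le> t + \<epsilon> / 2" for a b
    proof (rule DERIV_nonneg_imp_nondecreasing[OF \<open>a \<le> b\<close>])
      fix s assume "a \<le> s" "s \<le> b"
      then have "\<bar>s - t\<bar> < \<epsilon>" using that \<epsilon>(1) by linarith
      from \<epsilon>(2)[OF this] have "0 \<le> \<sigma> * d 1 s"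
        by (auto simp: \<sigma>_def sgn_if split: if_splits)
      then show "\<exists>y. ((\<lambda>s. \<sigma> * g s) has_real_derivative y) (at s) \<and> 0 \<le> y"
        using DERIV_cmult[OF g_deriv[of s], of \<sigma>] by blast
    qed
    have abs: "\<bar>g s\<bar> = \<bar>\<sigma> * g s\<bar>" for s using \<sigma> by (simp add: abs_mult)
    have "\<bar>g a\<bar> \<le> \<bar>g b\<bar>"
      if "t \<le> a \<and> a \<le> b \<and> b \<le> t + \<epsilon> / 2 \<or> t - \<epsilon> / 2 \<le> b \<and> b \<le> a \<and> a \<le> t" for a b
      using that mono[of t a] mono[of a b] mono[of b a] mono[of a t] True \<epsilon>(1)
      unfolding abs[of a] abs[of b] by auto
    then show ?thesis unfolding increasing_outward_def
      by (intro exI[of _ "\<epsilon> / 2"] exI[of _ "1::real"] conjI) (use \<epsilon>(1) in \<open>auto intro!: w_mono\<close>)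
  qed
qed

lemma increasing_outward_prod:
  assumes "finite I" "\<And>i. i \<in> I \<Longrightarrow> increasing_outward S (f i) y"
    "\<And>i x. i \<in> I \<Longrightarrow> x \<in> S \<Longrightarrow> 0 \<le> f i x"
  shows "increasing_outward S (\<lambda>x. \<Prod>i\<in>I. f i x) y"
  using assms
proof (induction I rule: finite_induct)
  case empty
  show ?case unfolding increasing_outward_def by (intro exI[of _ "1::real"] conjI) auto
next
  case (insert i I)
  obtain e c where e: "e > 0" "c > 0" and ec: "\<forall>a\<in>S. \<forall>b\<in>S.
     y \<le> a \<and> a \<le> b \<and> b \<le> y + e \<or> y - e \<le> b \<and> b \<le> a \<and> a \<le> y \<longrightarrow> c * f i a \<le> f i b"
    using insert.prems(1)[of i] unfolding increasing_outward_def by auto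
  have "increasing_outward S (\<lambda>x. \<Prod>i\<in>I. f i x) y" using insert by auto
  then obtain e' c' where e': "e' > 0" "c' > 0" and ec': "\<forall>a\<in>S. \<forall>b\<in>S.
     y \<le> a \<and> a \<le> b \<and> b \<le> y + e' \<or> y - e' \<le> b \<and> b \<le> a \<and> a \<le> y \<longrightarrow>
       c' * (\<Prod>i\<in>I. f i a) \<le> (\<Prod>i\<in>I. f i b)"
    unfolding increasing_outward_def by auto
  have "(c * c') * (\<Prod>i\<in>insert i I. f i a) \<le> (\<Prod>i\<in>insert i I. f i b)"
    if ab: "a \<in> S" "b \<in> S" and
      h: "y \<le> a \<and> a \<le> b \<and> b \<le> y + min e e' \<or> y - min e e' \<le> b \<and> b \<le> a \<and> a \<le> y" for a b
  proof -
    have "c * f i a \<le> f i b" using ab h by (intro ec[rule_format]) auto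
    moreover have "c' * (\<Prod>i\<in>I. f i a) \<le> (\<Prod>i\<in>I. f i b)" using ab h by (intro ec'[rule_format]) auto
    moreover have "0 \<le> f i b" "0 \<le> (\<Prod>i\<in>I. f i a)"
      using insert.prems(2) ab by (auto intro: prod_nonneg)
    ultimately have "(c * f i a) * (c' * (\<Prod>i\<in>I. f i a)) \<le> f i b * (\<Prod>i\<in>I. f i b)"
      using e'(2) by (intro mult_mono) auto
    then show ?thesis using insert.hyps by (simp add: mult_ac)
  qed
  then show ?case unfolding increasing_outward_def
    by (intro exI[of _ "min e e'"] exI[of _ "c * c'"] conjI) (use e e' in auto)
qed

section \<open>Transfer to [-1, 1] and uniformity in the point\<close>

text \<open>The arccosine is continuous and monotone, so closeness and betweenness pass from x to
  arccos x. It reverses the order, which is harmless because \<open>increasing_outward\<close>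
  treats both sides alike.\<close>

lemma Omega_cos_properties:
  assumes "(\<lambda>t. f (cos t)) \<in> Omega"
  shows "continuous_on {-1..1} f" "x \<in> {-1..1} \<Longrightarrow> 0 \<le> f x"
    "y \<in> {-1..1} \<Longrightarrow> increasing_outward {-1..1} f y"
proof -
  note w = Omega_properties[OF assms]
  have "continuous_on {-1..1} (\<lambda>x. f (cos (arccos x)))"
    using continuous_on_compose2[OF w(1) continuous_on_arccos'] by simp
  then show "continuous_on {-1..1} f"
    by (rule continuous_on_eq) auto
  show "x \<in> {-1..1} \<Longrightarrow> 0 \<le> f x" using w(2)[of "arccos x"] by simp
  assume y: "y \<in> {-1..1}"
  define t where "t = arccos y"
  obtain e c where e: "e > 0" "c > 0" and ec: "\<And>a b.
     t \<le> a \<and> a \<le> b \<and> b \<le> t + e \<or> t - e \<le> b \<and> b \<le> a \<and> a \<le> t \<Longrightarrow> c * f (cos a) \<le> f (cos b)"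
    using w(3)[of t] unfolding increasing_outward_def by blast
  obtain e' where e': "e' > 0" "\<And>x. x \<in> {-1..1} \<Longrightarrow> \<bar>x - y\<bar> < e' \<Longrightarrow> \<bar>arccos x - t\<bar> < e"
    using continuous_on_arccos' y e unfolding continuous_on_iff t_def dist_real_def by meson
  have "c * f a \<le> f b" if ab: "a \<in> {-1..1}" "b \<in> {-1..1}" and
    h: "y \<le> a \<and> a \<le> b \<and> b \<le> y + e' / 2 \<or> y - e' / 2 \<le> b \<and> b \<le> a \<and> a \<le> y" for a b
  proof -
    have "\<bar>b - y\<bar> < e'" using h e'(1) by linarith
    then have "\<bar>arccos b - t\<bar> < e" using e' ab by blast
    moreover have "arccos b \<le> arccos a \<and> arccos a \<le> t \<or> t \<le> arccos a \<and> arccos a \<le> arccos b"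
      using h ab y unfolding t_def by (auto intro!: arccos_le_arccos)
    ultimately have "c * f (cos (arccos a)) \<le> f (cos (arccos b))" by (intro ec) auto
    then show ?thesis using ab by simp
  qed
  then show "increasing_outward {-1..1} f y" unfolding increasing_outward_def
    by (intro exI[of _ "e' / 2"] exI[of _ c] conjI) (use e e' in auto)
qed

text \<open>A compactness argument. Near a centre y every x moves away from y, with a step and a
  constant that depend on y only; a finite subcover allows minima over the centres, since the
  property survives shrinking both.\<close>

lemma uniform_increasing_side:
  assumes out: "\<And>y. y \<in> {-1..1} \<Longrightarrow> increasing_outward {-1..1} w y"
    and nonneg: "\<And>x. x \<in> {-1..1} \<Longrightarrow> 0 \<le> w x"
  obtains \<delta> c :: real where "\<delta> > 0" "c > 0"
    "\<And>x. x \<in> {-1..1} \<Longrightarrow> \<exists>\<sigma>. \<bar>\<sigma>\<bar> = 1 \<and> x + \<sigma> * \<delta> \<in> {-1..1} \<and>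
       (\<forall>y. 0 \<le> \<sigma> * (y - x) \<and> \<sigma> * (y - x) \<le> \<delta> \<longrightarrow> c * w x \<le> w y)"
proof -
  define P where "P = (\<lambda>\<delta> c x. \<exists>\<sigma>. \<bar>\<sigma>\<bar> = 1 \<and> x + \<sigma> * \<delta> \<in> {-1..1} \<and>
       (\<forall>y. 0 \<le> \<sigma> * (y - x) \<and> \<sigma> * (y - x) \<le> \<delta> \<longrightarrow> c * w x \<le> w y))"
  have P_mono: "P \<delta>' c' x" if "P \<delta> c x" "0 < \<delta>'" "\<delta>' \<le> \<delta>" "c' \<le> c" "x \<in> {-1..1}" for \<delta> \<delta>' c c' x
  proof -
    obtain \<sigma> where \<sigma>: "\<bar>\<sigma>\<bar> = 1" "x + \<sigma> * \<delta> \<in> {-1..1}" and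
      *: "\<And>y. 0 \<le> \<sigma> * (y - x) \<Longrightarrow> \<sigma> * (y - x) \<le> \<delta> \<Longrightarrow> c * w x \<le> w y"
      using \<open>P \<delta> c x\<close> unfolding P_def by blast
    have "\<sigma> = 1 \<or> \<sigma> = -1" using \<sigma> by auto
    then have "x + \<sigma> * \<delta>' \<in> {-1..1}" using \<sigma>(2) that by auto
    moreover have "c' * w x \<le> c * w x" using that nonneg by (intro mult_right_mono) auto
    ultimately show ?thesis unfolding P_def using \<sigma>(1) * that(3)
      by (intro exI[of _ \<sigma>]) (meson order_trans)
  qed
  have "\<exists>e>0. \<exists>c>0. \<forall>x\<in>{-1..1}. \<bar>x - y\<bar> < e \<longrightarrow> P e c x" if y: "y \<in> {-1..1}" for y
  proof -
    obtain \<epsilon> c where \<epsilon>: "\<epsilon> > 0" "c > 0" and *: "\<And>a b. a \<in> {-1..1} \<Longrightarrow> b \<in> {-1..1} \<Longrightarrow>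
      y \<le> a \<and> a \<le> b \<and> b \<le> y + \<epsilon> \<or> y - \<epsilon> \<le> b \<and> b \<le> a \<and> a \<le> y \<Longrightarrow> c * w a \<le> w b"
      using out[OF y] unfolding increasing_outward_def by blast
    \<comment> \<open>A point within e of y moves by e, so 2 e must not exceed
      \<open>\<epsilon>\<close> or the distance from y to an endpoint other than y itself; the value
      1 stands in when y is that endpoint.\<close>
    define e where "e = min (\<epsilon> / 2) (min (if y < 1 then (1 - y) / 2 else 1) (if -1 < y then (y + 1) / 2 else 1))"
    have e: "e > 0" "e \<le> \<epsilon> / 2" "y < 1 \<Longrightarrow> e \<le> (1 - y) / 2" "-1 < y \<Longrightarrow> e \<le> (y + 1) / 2"
      using \<epsilon> y unfolding e_def by (auto simp: min_def)
    have "P e c x" if x: "x \<in> {-1..1}" "\<bar>x - y\<bar> < e" for x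
    proof (cases "y \<le> x \<and> y < 1")
      case True
      have r: "x + e \<le> 1" "x + e \<le> y + \<epsilon>" using True x e by auto
      show ?thesis unfolding P_def
        by (rule exI[of _ 1]) (use r x e True in \<open>auto intro!: *\<close>)
    next
      case False
      then have F: "x \<le> y" "-1 < y" using x y by auto
      have r: "-1 \<le> x - e" "y - \<epsilon> \<le> x - e" using F x e by auto
      show ?thesis unfolding P_def
        by (rule exI[of _ "-1"]) (use r x e F in \<open>auto intro!: *\<close>)
    qed
    then show ?thesis using e(1) \<epsilon>(2) by blast
  qed
  then obtain e c where ec: "\<And>y. y \<in> {-1..1} \<Longrightarrow> e y > 0" "\<And>y. y \<in> {-1..1} \<Longrightarrow> c y > 0"
    "\<And>x y. y \<in> {-1..1} \<Longrightarrow> x \<in> {-1..1} \<Longrightarrow> \<bar>x - y\<bar> < e y \<Longrightarrow> P (e y) (c y) x"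
    by metis
  have cover: "{-1..1} \<subseteq> (\<Union>y\<in>{-1..1}. ball y (e y))" using ec(1) by force
  obtain D where D: "D \<subseteq> {-1..1}" "finite D" "{-1..1} \<subseteq> (\<Union>y\<in>D. ball y (e y))"
    by (rule compactE_image[OF compact_Icc _ cover]) auto
  have "D \<noteq> {}" using D(3) by force
  show thesis
  proof (rule that[of "Min (e ` D)" "Min (c ` D)"])
    show pos: "Min (e ` D) > 0" "Min (c ` D) > 0" using D ec \<open>D \<noteq> {}\<close> by auto
    fix x :: real assume x: "x \<in> {-1..1}"
    then obtain y where y: "y \<in> D" "\<bar>x - y\<bar> < e y"
      using D(3) by (auto simp: dist_real_def abs_minus_commute)
    then have "P (e y) (c y) x" using ec(3) D x by blast
    then show "\<exists>\<sigma>. \<bar>\<sigma>\<bar> = 1 \<and> x + \<sigma> * Min (e ` D) \<in> {-1..1} \<and>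
       (\<forall>ya. 0 \<le> \<sigma> * (ya - x) \<and> \<sigma> * (ya - x) \<le> Min (e ` D) \<longrightarrow> Min (c ` D) * w x \<le> w ya)"
      using P_mono[of "e y" "c y" x "Min (e ` D)" "Min (c ` D)"] pos(1) x y D
      unfolding P_def by auto
  qed
qed

section \<open>Growth and density of weights\<close>

definition mass :: "(real \<Rightarrow> real) \<Rightarrow> real \<Rightarrow> real \<Rightarrow> real" where
  "mass u a b = (LINT x:{a<..b}|lebesgue. u x)"

text \<open>The common consequences of \<open>A_infinity\<close> and \<open>A_star\<close> on which both parts rest.\<close>
definition regular_weight :: "(real \<Rightarrow> real) \<Rightarrow> bool" where
  "regular_weight u \<longleftrightarrow> weight u \<and>
     (\<exists>K>0. \<exists>s::nat. \<forall>a' a b b'. -1 \<le> a' \<and> a' \<le> a \<and> a < b \<and> b \<le> b' \<and> b' \<le> 1 \<longrightarrow>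
        mass u a' b' \<le> K * ((b' - a') / (b - a)) ^ s * mass u a b) \<and>
     (\<exists>\<tau>>0. \<exists>\<eta>>0. \<forall>a b. -1 \<le> a \<and> a < b \<and> b \<le> 1 \<longrightarrow>
        \<tau> * (b - a) \<le> measure lebesgue {x\<in>{a<..b}. \<eta> * (mass u a b / (b - a)) \<le> u x})"

lemma regular_weightI:
  assumes "weight u" "\<tau> > 0" "\<eta> > 0"
    "\<exists>K>0. \<exists>s::nat. \<forall>a' a b b'. -1 \<le> a' \<and> a' \<le> a \<and> a < b \<and> b \<le> b' \<and> b' \<le> 1 \<longrightarrow>
        mass u a' b' \<le> K * ((b' - a') / (b - a)) ^ s * mass u a b"
    "\<And>a b. -1 \<le> a \<Longrightarrow> a < b \<Longrightarrow> b \<le> 1 \<Longrightarrow>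
      \<tau> * (b - a) \<le> measure lebesgue {x\<in>{a<..b}. \<eta> * (mass u a b / (b - a)) \<le> u x}"
  shows "regular_weight u"
  unfolding regular_weight_def using assms by blast

lemma weight_integrable:
  assumes "weight u" "A \<in> sets lebesgue" "A \<subseteq> {-1..1}"
  shows "set_integrable lebesgue A u"
  using assms set_integrable_subset unfolding weight_def by blast

lemma weight_integral_mono:
  assumes "weight u" "A \<in> sets lebesgue" "B \<in> sets lebesgue" "A \<subseteq> B" "B \<subseteq> {-1..1}"
  shows "(LINT x:A|lebesgue. u x) \<le> (LINT x:B|lebesgue. u x)"
  unfolding set_lebesgue_integral_def
proof (rule integral_mono)
  show "integrable lebesgue (\<lambda>x. indicat_real A x *\<^sub>R u x)"
    using weight_integrable[of u A] assms unfolding set_integrable_def by auto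
  show "integrable lebesgue (\<lambda>x. indicat_real B x *\<^sub>R u x)"
    using weight_integrable[of u B] assms unfolding set_integrable_def by auto
  show "indicat_real A x *\<^sub>R u x \<le> indicat_real B x *\<^sub>R u x" for x
    using assms by (auto simp: indicator_def weight_def)
qed

lemma weight_integral_nonneg:
  assumes "weight u" "A \<subseteq> {-1..1}"
  shows "0 \<le> (LINT x:A|lebesgue. u x)"
  using assms unfolding set_lebesgue_integral_def weight_def
  by (intro integral_nonneg_AE) (auto simp: indicator_def)

lemma weight_integral_Un:
  assumes "weight u" "A \<in> sets lebesgue" "B \<in> sets lebesgue" "A \<inter> B = {}" "A \<union> B \<subseteq> {-1..1}"
  shows "(LINT x:A \<union> B|lebesgue. u x) = (LINT x:A|lebesgue. u x) + (LINT x:B|lebesgue. u x)"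
  using assms by (intro set_integral_Un weight_integrable) auto

lemma weight_integral_le:
  assumes "weight u" "A \<in> lmeasurable" "A \<subseteq> {-1..1}" "\<And>x. x \<in> A \<Longrightarrow> u x \<le> c"
  shows "(LINT x:A|lebesgue. u x) \<le> c * measure lebesgue A"
proof -
  have "set_integrable lebesgue A (\<lambda>_. c)"
    using assms(2) unfolding set_integrable_def
    by (intro integrable_scaleR_left integrable_real_indicator) (auto simp: fmeasurable_def)
  then have "(LINT x:A|lebesgue. u x) \<le> (LINT x:A|lebesgue. c)"
    using assms by (intro set_integral_mono weight_integrable[OF assms(1)]) auto
  also have "\<dots> = c * measure lebesgue A"
    using assms(2) by (simp add: set_lebesgue_integral_def)
  finally show ?thesis .
qed

text \<open>A weight is controlled on [-1, 1] only, so measurability is stated for its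
  cut-off.\<close>

lemma weight_measurable:
  assumes "weight u"
  shows "(\<lambda>x. indicat_real {-1..1} x * u x) \<in> borel_measurable lebesgue"
  using assms unfolding weight_def set_integrable_def by (auto dest: borel_measurable_integrable)

lemma weight_superlevel:
  assumes "weight u" "-1 \<le> a" "b \<le> 1"
  shows "{x\<in>{a<..b}. c \<le> u x} \<in> lmeasurable" "{x\<in>{a<..b}. u x < c} \<in> lmeasurable"
proof -
  have *: "{x. c \<le> indicat_real {-1..1} x * u x} \<in> sets lebesgue"
    "{x. indicat_real {-1..1} x * u x < c} \<in> sets lebesgue"
    using measurable_sets[OF weight_measurable[OF assms(1)], of "{c..}"]
      measurable_sets[OF weight_measurable[OF assms(1)], of "{..<c}"] by (auto simp: vimage_def)
  have "{x\<in>{a<..b}. c \<le> u x} = {x. c \<le> indicat_real {-1..1} x * u x} \<inter> {a<..b}"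
    "{x\<in>{a<..b}. u x < c} = {x. indicat_real {-1..1} x * u x < c} \<inter> {a<..b}"
    using assms by (auto simp: indicator_def)
  moreover have "{a<..b} \<in> lmeasurable" by (intro bounded_set_imp_lmeasurable) auto
  ultimately show "{x\<in>{a<..b}. c \<le> u x} \<in> lmeasurable" "{x\<in>{a<..b}. u x < c} \<in> lmeasurable"
    using * by (auto intro: fmeasurable_Int_fmeasurable simp: Int_commute)
qed

lemma measure_Ioc: "a \<le> b \<Longrightarrow> measure lebesgue {a<..b} = b - a" for a b :: real
  by (simp add: measure_completion)

lemma measure_superlevel:
  assumes "weight u" "-1 \<le> a" "a < b" "b \<le> 1"
  shows "measure lebesgue {x\<in>{a<..b}. c \<le> u x} + measure lebesgue {x\<in>{a<..b}. u x < c} = b - a"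
proof -
  have "measure lebesgue ({x\<in>{a<..b}. c \<le> u x} \<union> {x\<in>{a<..b}. u x < c}) =
      measure lebesgue {x\<in>{a<..b}. c \<le> u x} + measure lebesgue {x\<in>{a<..b}. u x < c}"
  proof (subst measure_Un3)
    have "{x\<in>{a<..b}. c \<le> u x} \<inter> {x\<in>{a<..b}. u x < c} = {}" by auto
    then show "measure lebesgue {x\<in>{a<..b}. c \<le> u x} + measure lebesgue {x\<in>{a<..b}. u x < c} -
        measure lebesgue ({x\<in>{a<..b}. c \<le> u x} \<inter> {x\<in>{a<..b}. u x < c}) =
        measure lebesgue {x\<in>{a<..b}. c \<le> u x} + measure lebesgue {x\<in>{a<..b}. u x < c}"
      by (simp only: measure_empty)
  qed (use assms in \<open>intro weight_superlevel; simp\<close>)+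
  moreover have "{x\<in>{a<..b}. c \<le> u x} \<union> {x\<in>{a<..b}. u x < c} = {a<..b}" by auto
  ultimately show ?thesis using assms by (simp add: measure_Ioc)
qed

section \<open>From doubling to polynomial growth\<close>

text \<open>Shrinking the interval i times by the ratio \<open>\<theta>\<close> costs
  \<open>K ^ i\<close>. The number of steps is logarithmic in the ratio of the lengths, so this cost
  is at most a power of that ratio.\<close>

lemma growth_of_doubling:
  fixes U :: "real \<Rightarrow> real \<Rightarrow> real" and K \<theta> :: real
  assumes \<theta>: "0 < \<theta>" "\<theta> < 1" and K: "1 \<le> K"
    and U: "\<And>a b. -1 \<le> a \<Longrightarrow> a < b \<Longrightarrow> b \<le> 1 \<Longrightarrow> 0 \<le> U a b"
    and step: "\<And>a' a b b'. -1 \<le> a' \<Longrightarrow> a' \<le> a \<Longrightarrow> a < b \<Longrightarrow> b \<le> b' \<Longrightarrow> b' \<le> 1 \<Longrightarrow>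
      \<theta> * (b' - a') \<le> b - a \<Longrightarrow> U a' b' \<le> K * U a b"
  shows "\<exists>K>0. \<exists>s::nat. \<forall>a' a b b'. -1 \<le> a' \<and> a' \<le> a \<and> a < b \<and> b \<le> b' \<and> b' \<le> 1 \<longrightarrow>
        U a' b' \<le> K * ((b' - a') / (b - a)) ^ s * U a b"
proof -
  have iter: "U a' b' \<le> K ^ i * U a b"
    if "-1 \<le> a'" "a' \<le> a" "a < b" "b \<le> b'" "b' \<le> 1" "\<theta> ^ i * (b' - a') \<le> b - a" for i a' a b b'
    using that
  proof (induction i arbitrary: a b)
    case 0
    then have "a = a'" "b = b'" by auto
    then show ?case by simp
  next
    case (Suc i)
    have U0: "0 \<le> U a b" using Suc.prems by (intro U) auto
    show ?case
    proof (cases "\<theta> * (b' - a') \<le> b - a")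
      case True
      then have "U a' b' \<le> K * U a b" using Suc.prems by (intro step) auto
      also have "\<dots> \<le> K ^ Suc i * U a b"
        using K U0 by (intro mult_right_mono) (auto simp: mult_le_cancel_left1)
      finally show ?thesis .
    next
      case False
      define l L where "l = b - a" and "L = b' - a'"
      have l: "0 < l" "l < \<theta> * L" using False Suc.prems by (auto simp: l_def L_def)
      have "l / \<theta> < L" using l \<theta> by (simp add: field_simps)
      moreover have l\<theta>: "l \<le> l / \<theta>" using l \<theta> by (simp add: field_simps)
      ultimately have lL: "l < L" by simp
      \<comment> \<open>Linear interpolation between the inner and the outer interval yields an
        interval of length exactly \<open>l / \<theta>\<close> between them.\<close>
      define \<kappa> where "\<kappa> = (l / \<theta> - l) / (L - l)"
      have \<kappa>: "0 \<le> \<kappa>" "\<kappa> \<le> 1" using lL l\<theta> \<open>l / \<theta> < L\<close> by (auto simp: \<kappa>_def)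
      define a2 b2 where "a2 = a - \<kappa> * (a - a')" and "b2 = b + \<kappa> * (b' - b)"
      have "b2 - a2 = l + \<kappa> * (L - l)" by (simp add: a2_def b2_def l_def L_def algebra_simps)
      also have "\<dots> = l / \<theta>" using lL by (simp add: \<kappa>_def)
      finally have len: "b2 - a2 = l / \<theta>" .
      have "\<kappa> * (a - a') \<le> 1 * (a - a')" "\<kappa> * (b' - b) \<le> 1 * (b' - b)"
        using mult_right_mono[of \<kappa> 1 "a - a'"] mult_right_mono[of \<kappa> 1 "b' - b"] \<kappa> Suc.prems
        by auto
      moreover have "0 \<le> \<kappa> * (a - a')" "0 \<le> \<kappa> * (b' - b)" using \<kappa> Suc.prems by auto
      ultimately have pos: "a' \<le> a2" "a2 \<le> a" "b \<le> b2" "b2 \<le> b'"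
        by (auto simp: a2_def b2_def)
      have "\<theta> * (\<theta> ^ i * L) \<le> l" using Suc.prems by (simp add: l_def L_def mult.assoc)
      then have "\<theta> ^ i * (b' - a') \<le> b2 - a2"
        unfolding len L_def[symmetric] using \<theta> by (simp add: field_simps)
      then have "U a' b' \<le> K ^ i * U a2 b2" using Suc.prems pos by (intro Suc.IH) auto
      also have "U a2 b2 \<le> K * U a b"
        using Suc.prems pos len \<theta> by (intro step) (auto simp: l_def)
      finally show ?thesis using K by (simp add: mult_ac mult_left_mono)
    qed
  qed
  \<comment> \<open>The exponent s converts powers of K into powers of
    \<open>1 / \<theta>\<close>.\<close>
  obtain s where s: "K < (1 / \<theta>) ^ s" using real_arch_pow[of "1 / \<theta>" K] \<theta> by auto
  have \<theta>1: "1 \<le> 1 / \<theta>" using \<theta> by simp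
  show ?thesis
  proof (intro exI[of _ "(1 / \<theta>) ^ s"] exI[of _ s] conjI allI impI)
    show "(1 / \<theta>) ^ s > 0" using \<theta> by simp
    fix a' a b b' :: real
    assume h: "-1 \<le> a' \<and> a' \<le> a \<and> a < b \<and> b \<le> b' \<and> b' \<le> 1"
    define l L where "l = b - a" and "L = b' - a'"
    have l: "0 < l" "l \<le> L" using h by (auto simp: l_def L_def)
    \<comment> \<open>By minimality the last step overshoots by at most one factor, so
      \<open>(1 / \<theta>) ^ i\<close> is at most \<open>1 / \<theta>\<close> times L / l.\<close>
    define i where "i = (LEAST i. \<theta> ^ i * L \<le> l)"
    obtain i0 where "\<theta> ^ i0 < l / L" using real_arch_pow_inv[of "l / L" \<theta>] l \<theta> by auto
    then have "\<theta> ^ i0 * L \<le> l" using l by (simp add: field_simps)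
    then have i: "\<theta> ^ i * L \<le> l" unfolding i_def by (rule LeastI)
    have "(1 / \<theta>) ^ i \<le> 1 / \<theta> * (L / l)"
    proof (cases i)
      case 0
      have "1 * 1 \<le> 1 / \<theta> * (L / l)" using \<theta>1 \<theta>(1) l by (intro mult_mono) auto
      then show ?thesis using 0 by simp
    next
      case (Suc i')
      then have "i' < (LEAST i. \<theta> ^ i * L \<le> l)" by (simp add: i_def)
      then have "\<not> \<theta> ^ i' * L \<le> l" by (rule not_less_Least)
      then have "(1 / \<theta>) ^ i' \<le> L / l" using \<theta> l by (simp add: field_simps power_divide)
      then show ?thesis
        using Suc \<theta> mult_left_mono[of "(1 / \<theta>) ^ i'" "L / l" "1 / \<theta>"] by simp
    qed
    then have "((1 / \<theta>) ^ i) ^ s \<le> (1 / \<theta> * (L / l)) ^ s" using \<theta>(1) by (intro power_mono) auto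
    moreover have "K ^ i \<le> ((1 / \<theta>) ^ s) ^ i" using s K by (intro power_mono) auto
    ultimately have Ki: "K ^ i \<le> (1 / \<theta>) ^ s * (L / l) ^ s"
      by (metis (no_types, lifting) mult.commute order_trans power_mult power_mult_distrib)
    have "U a' b' \<le> K ^ i * U a b" using h i by (intro iter) (auto simp: l_def L_def)
    also have "\<dots> \<le> (1 / \<theta>) ^ s * (L / l) ^ s * U a b"
      using Ki h by (intro mult_right_mono U) auto
    finally show "U a' b' \<le> (1 / \<theta>) ^ s * ((b' - a') / (b - a)) ^ s * U a b"
      by (simp add: l_def L_def)
  qed
qed

section \<open>Regularity from \<open>A_infinity\<close> and from \<open>A_star\<close>\<close>

text \<open>The condition is taken at \<open>\<alpha> = 1 / 2\<close>. For subintervals it is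
  doubling. For density, a set of more than half the length on which u is below
  \<open>\<beta> / 2\<close> times its average would carry too little mass.\<close>

lemma A_infinity_regular:
  assumes "u \<in> A_infinity"
  shows "regular_weight u"
proof -
  have wt: "weight u" using assms by (simp add: A_infinity_def)
  have "\<exists>\<beta>>0. \<forall>I E. is_interval I \<and> I \<subseteq> {-1..1} \<and>
        E \<in> sets lebesgue \<and> E \<subseteq> I \<and> measure lebesgue E \<ge> 1 / 2 * measure lebesgue I \<longrightarrow>
        (LINT x:E|lebesgue. u x) \<ge> \<beta> * (LINT x:I|lebesgue. u x)"
    using assms unfolding A_infinity_def by (auto dest!: spec[of _ "1 / 2"])
  then obtain \<beta> where \<beta>: "\<beta> > 0" and H: "\<forall>I E. is_interval I \<and> I \<subseteq> {-1..1} \<and>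
        E \<in> sets lebesgue \<and> E \<subseteq> I \<and> measure lebesgue E \<ge> 1 / 2 * measure lebesgue I \<longrightarrow>
        (LINT x:E|lebesgue. u x) \<ge> \<beta> * (LINT x:I|lebesgue. u x)"
    by blast
  have *: "\<beta> * mass u a b \<le> (LINT x:E|lebesgue. u x)"
    if "-1 \<le> a" "a < b" "b \<le> 1" "E \<in> sets lebesgue" "E \<subseteq> {a<..b}"
      "1 / 2 * (b - a) \<le> measure lebesgue E" for a b E
    unfolding mass_def using that
    by (intro H[rule_format] conjI) (auto simp: is_interval_oc measure_Ioc)
  have mass_nonneg: "0 \<le> mass u a b" if "-1 \<le> a" "b \<le> 1" for a b
    unfolding mass_def using wt that by (intro weight_integral_nonneg) auto
  have growth: "\<exists>K>0. \<exists>s::nat. \<forall>a' a b b'. -1 \<le> a' \<and> a' \<le> a \<and> a < b \<and> b \<le> b' \<and> b' \<le> 1 \<longrightarrow>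
        mass u a' b' \<le> K * ((b' - a') / (b - a)) ^ s * mass u a b"
  proof (rule growth_of_doubling)
    show "(0::real) < 1 / 2" "(1 / 2 :: real) < 1" "1 \<le> max 1 (1 / \<beta>)" by auto
    fix a' a b b' :: real
    assume h: "-1 \<le> a'" "a' \<le> a" "a < b" "b \<le> b'" "b' \<le> 1" "1 / 2 * (b' - a') \<le> b - a"
    have "\<beta> * mass u a' b' \<le> mass u a b"
      unfolding mass_def[of u a b] using h by (intro *) (auto simp: measure_Ioc)
    then have "mass u a' b' \<le> 1 / \<beta> * mass u a b" using \<beta> by (simp add: field_simps)
    also have "\<dots> \<le> max 1 (1 / \<beta>) * mass u a b"
      using h by (intro mult_right_mono mass_nonneg) auto
    finally show "mass u a' b' \<le> max 1 (1 / \<beta>) * mass u a b" .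
  qed (auto intro: mass_nonneg)
  have density: "1 / 2 * (b - a) \<le> measure lebesgue {x\<in>{a<..b}. \<beta> / 2 * (mass u a b / (b - a)) \<le> u x}"
    if ab: "-1 \<le> a" "a < b" "b \<le> 1" for a b
  proof (rule ccontr)
    define c where "c = \<beta> / 2 * (mass u a b / (b - a))"
    define B where "B = {x\<in>{a<..b}. u x < c}"
    assume "\<not> ?thesis"
    moreover have "1 / 2 * l < y" if "\<not> 1 / 2 * l \<le> x" "x + y = l" for x y l :: real
      using that by linarith
    ultimately have B: "1 / 2 * (b - a) < measure lebesgue B"
      using measure_superlevel[OF wt ab, of c] unfolding B_def c_def by blast
    have Bm: "B \<in> lmeasurable" unfolding B_def using wt ab by (intro weight_superlevel) auto
    \<comment> \<open>B is nonempty and u is nonnegative, so the threshold is positive; the estimate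
      below forces the mass, and with it the threshold, to be at most 0.\<close>
    have "c > 0"
    proof (rule ccontr)
      assume "\<not> c > 0"
      moreover have "0 \<le> u x" if "x \<in> {a<..b}" for x using wt ab that by (auto simp: weight_def)
      ultimately have "\<not> u x < c" if "x \<in> {a<..b}" for x using that by (meson le_less_trans not_le)
      then have "B = {}" by (auto simp: B_def)
      then show False using B ab by simp
    qed
    have "\<beta> * mass u a b \<le> (LINT x:B|lebesgue. u x)"
      using ab B Bm by (intro *) (auto simp: B_def)
    also have "\<dots> \<le> c * measure lebesgue B"
      using Bm ab by (intro weight_integral_le[OF wt]) (auto simp: B_def)
    also have "\<dots> \<le> c * (b - a)"
      using measure_superlevel[OF wt ab, of c] measure_nonneg[of lebesgue "{x\<in>{a<..b}. c \<le> u x}"] \<open>c > 0\<close>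
      unfolding B_def by (intro mult_left_mono) linarith+
    also have "c * (b - a) = \<beta> / 2 * (mass u a b / (b - a) * (b - a))"
      by (simp only: c_def mult.assoc)
    also have "mass u a b / (b - a) * (b - a) = mass u a b" using ab by simp
    finally have "\<beta> * mass u a b \<le> 0" using \<open>c > 0\<close> by simp
    then have "mass u a b \<le> 0" using \<beta> by (simp add: mult_le_0_iff)
    then have "c \<le> 0" unfolding c_def using \<beta> ab by (intro mult_nonneg_nonpos divide_nonpos_pos) auto
    then show False using \<open>c > 0\<close> by simp
  qed
  show ?thesis
    by (rule regular_weightI[OF wt _ _ growth density]) (use \<beta> in auto)
qed

lemma A_star_bound:
  assumes "u \<in> A_star"
  obtains L where "L \<ge> 1"
    "\<And>a b x. -1 \<le> a \<Longrightarrow> a < b \<Longrightarrow> b \<le> 1 \<Longrightarrow> x \<in> {a<..b} \<Longrightarrow> u x \<le> L * (mass u a b / (b - a))"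
proof -
  have wt: "weight u" using assms by (simp add: A_star_def)
  obtain L where L: "\<And>I x. is_interval I \<Longrightarrow> I \<subseteq> {-1..1} \<Longrightarrow> measure lebesgue I > 0 \<Longrightarrow> x \<in> I \<Longrightarrow>
       u x \<le> L / measure lebesgue I * (LINT y:I|lebesgue. u y)"
    using assms unfolding A_star_def by blast
  show thesis
  \<comment> \<open>Averages of u are nonnegative, so L may be enlarged; L >= 1 makes both 1 / (2 L)
    and 1 - 1 / (2 L) positive later.\<close>
  proof (rule that[of "max 1 L"])
    fix a b x :: real assume h: "-1 \<le> a" "a < b" "b \<le> 1" "x \<in> {a<..b}"
    have "u x \<le> L / measure lebesgue {a<..b} * (LINT y:{a<..b}|lebesgue. u y)"
      using h by (intro L) (auto simp: is_interval_oc measure_Ioc)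
    also have "\<dots> = L * (mass u a b / (b - a))" using h by (simp add: mass_def measure_Ioc)
    also have "\<dots> \<le> max 1 L * (mass u a b / (b - a))"
      unfolding mass_def using h wt
      by (intro mult_right_mono divide_nonneg_pos weight_integral_nonneg) auto
    finally show "u x \<le> max 1 L * (mass u a b / (b - a))" .
  qed simp
qed

text \<open>If the uncovered part of the larger interval has at most the fraction 1 / (2 L) of its
  length, the bound of u by L times the average leaves at most half the mass there; this is doubling
  with constant 2. For density, points with u below half the average carry at most half the mass, so
  the others, where u is at most L times the average, fill at least the fraction 1 / (2 L).\<close>

lemma A_star_regular:
  assumes "u \<in> A_star"
  shows "regular_weight u"
proof -
  have wt: "weight u" using assms by (simp add: A_star_def)
  obtain L where L: "L \<ge> 1"
    and *: "\<And>a b x. -1 \<le> a \<Longrightarrow> a < b \<Longrightarrow> b \<le> 1 \<Longrightarrow> x \<in> {a<..b} \<Longrightarrow> u x \<le> L * (mass u a b / (b - a))"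
    using A_star_bound[OF assms] by metis
  have mass_nonneg: "0 \<le> mass u a b" if "-1 \<le> a" "b \<le> 1" for a b
    unfolding mass_def using wt that by (intro weight_integral_nonneg) auto
  have growth: "\<exists>K>0. \<exists>s::nat. \<forall>a' a b b'. -1 \<le> a' \<and> a' \<le> a \<and> a < b \<and> b \<le> b' \<and> b' \<le> 1 \<longrightarrow>
        mass u a' b' \<le> K * ((b' - a') / (b - a)) ^ s * mass u a b"
  proof (rule growth_of_doubling)
    show "(0::real) < 1 - 1 / (2 * L)" "1 - 1 / (2 * L) < 1" "(1::real) \<le> 2"
      using L by (auto simp: field_simps)
    fix a' a b b' :: real
    assume h: "-1 \<le> a'" "a' \<le> a" "a < b" "b \<le> b'" "b' \<le> 1" "(1 - 1 / (2 * L)) * (b' - a') \<le> b - a"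
    define c where "c = L * (mass u a' b' / (b' - a'))"
    have c: "0 \<le> c" unfolding c_def using L h by (intro mult_nonneg_nonneg divide_nonneg_pos mass_nonneg) auto
    have piece: "(LINT x:{s<..t}|lebesgue. u x) \<le> c * (t - s)" if "a' \<le> s" "s \<le> t" "t \<le> b'" for s t
      using weight_integral_le[OF wt, of "{s<..t}" c] that h *[of a' b']
      by (force simp: measure_Ioc c_def intro: bounded_set_imp_lmeasurable)
    have "{a'<..b'} = ({a'<..a} \<union> {a<..b}) \<union> {b<..b'}" using h by auto
    then have "mass u a' b' = (LINT x:({a'<..a} \<union> {a<..b}) \<union> {b<..b'}|lebesgue. u x)"
      by (simp add: mass_def)
    also have "\<dots> = (LINT x:{a'<..a}|lebesgue. u x) + mass u a b + (LINT x:{b<..b'}|lebesgue. u x)"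
      unfolding mass_def using h by (subst weight_integral_Un[OF wt], auto)+
    also have "\<dots> \<le> c * (a - a') + mass u a b + c * (b' - b)"
      using h by (intro add_mono piece) auto
    also have "\<dots> = mass u a b + c * ((b' - a') - (b - a))" by (simp add: algebra_simps)
    also have "\<dots> \<le> mass u a b + c * (1 / (2 * L) * (b' - a'))"
      using h(6) c by (intro add_left_mono mult_left_mono) (auto simp: algebra_simps)
    also have "c * (1 / (2 * L) * (b' - a')) = mass u a' b' / 2"
      unfolding c_def using L h by (simp add: field_simps)
    finally show "mass u a' b' \<le> 2 * mass u a b" by simp
  qed (auto intro: mass_nonneg)
  have density: "1 / (2 * L) * (b - a) \<le> measure lebesgue {x\<in>{a<..b}. 1 / 2 * (mass u a b / (b - a)) \<le> u x}"
    if ab: "-1 \<le> a" "a < b" "b \<le> 1" for a b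
  proof (cases "mass u a b = 0")
    case True
    then have "{x\<in>{a<..b}. 1 / 2 * (mass u a b / (b - a)) \<le> u x} = {a<..b}"
      using ab wt by (auto simp: weight_def)
    moreover have "1 / (2 * L) * (b - a) \<le> 1 * (b - a)"
      using L ab by (intro mult_right_mono) (auto simp: field_simps)
    ultimately show ?thesis using ab by (simp add: measure_Ioc)
  next
    case False
    then have mpos: "0 < mass u a b" using mass_nonneg[of a b] ab by auto
    define c where "c = 1 / 2 * (mass u a b / (b - a))"
    define E where "E = {x\<in>{a<..b}. c \<le> u x}"
    define B where "B = {x\<in>{a<..b}. u x < c}"
    have m: "E \<in> lmeasurable" "B \<in> lmeasurable"
      unfolding E_def B_def using wt ab by (auto intro!: weight_superlevel simp del: greaterThanAtMost_iff)
    have "E \<union> B = {a<..b}" by (auto simp: E_def B_def)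
    then have "mass u a b = (LINT x:E \<union> B|lebesgue. u x)" by (simp add: mass_def)
    also have "\<dots> = (LINT x:E|lebesgue. u x) + (LINT x:B|lebesgue. u x)"
      using m ab by (intro weight_integral_Un[OF wt]) (auto simp: E_def B_def)
    finally have sum: "mass u a b = (LINT x:E|lebesgue. u x) + (LINT x:B|lebesgue. u x)" .
    have le: "(LINT x:E|lebesgue. u x) \<le> L * (mass u a b / (b - a)) * measure lebesgue E"
      using m ab * by (intro weight_integral_le[OF wt]) (auto simp: E_def)
    have "0 < c" using mpos ab by (simp add: c_def)
    have "(LINT x:B|lebesgue. u x) \<le> c * measure lebesgue B"
      using m ab by (intro weight_integral_le[OF wt]) (auto simp: B_def)
    also have "\<dots> \<le> c * (b - a)"
      using measure_superlevel[OF wt ab, of c] measure_nonneg[of lebesgue "{x\<in>{a<..b}. c \<le> u x}"] \<open>0 < c\<close>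
      unfolding B_def by (intro mult_left_mono) linarith+
    also have "\<dots> = 1 / 2 * (mass u a b / (b - a) * (b - a))"
      by (simp only: c_def mult.assoc)
    also have "mass u a b / (b - a) * (b - a) = mass u a b" using ab by simp
    finally have "1 / 2 * mass u a b \<le> L * (mass u a b / (b - a)) * measure lebesgue E"
      using sum le by linarith
    then have "mass u a b * (1 / 2) \<le> mass u a b * (L / (b - a) * measure lebesgue E)"
      by (simp add: mult_ac)
    then have "1 / 2 \<le> L / (b - a) * measure lebesgue E"
      using mpos by (simp only: mult_le_cancel_left_pos)
    then have "1 / (2 * L) * (b - a) \<le> measure lebesgue E" using L ab by (simp add: field_simps)
    then show ?thesis by (simp only: E_def c_def)
  qed
  show ?thesis
    by (rule regular_weightI[OF wt _ _ growth density]) (use L in auto)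
qed

section \<open>Nikolskii inequalities\<close>

lemma cell_unique:
  assumes "x \<in> cell N j" "x \<in> cell N k"
  shows "j = k"
proof (cases "N = 0")
  case False
  then have "2 * real j < real N * (x + 1)" "real N * (x + 1) \<le> 2 * real j + 2"
    "2 * real k < real N * (x + 1)" "real N * (x + 1) \<le> 2 * real k + 2"
    using assms by (auto simp: cell_def field_simps)
  then have "real j < real k + 1" "real k < real j + 1" by linarith+
  then show ?thesis by linarith
qed (use assms in \<open>auto simp: cell_def\<close>)

lemma cell_cover:
  assumes "x \<in> {-1<..1}" "N \<ge> 1"
  obtains j where "j < N" "x \<in> cell N j"
proof -
  define y where "y = real N * (x + 1) / 2"
  have "0 < real N * (x + 1)" "real N * (x + 1) \<le> real N * 2"
    using assms by (auto intro!: mult_pos_pos mult_left_mono)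
  then have y: "0 < y" "y \<le> real N" by (auto simp: y_def)
  \<comment> \<open>Cells are closed on the right: a y in (j, j + 1] has ceiling j + 1.\<close>
  define j where "j = nat \<lceil>y\<rceil> - 1"
  have pos: "0 < \<lceil>y\<rceil>" using y by simp
  have "real (nat \<lceil>y\<rceil>) = of_int \<lceil>y\<rceil>" by (rule of_nat_nat[OF less_imp_le[OF pos]])
  moreover have "1 \<le> nat \<lceil>y\<rceil>" using pos by linarith
  ultimately have j: "real j = of_int \<lceil>y\<rceil> - 1" by (simp only: j_def of_nat_diff of_nat_1)
  have "real j < y" "y \<le> real j + 1"
    unfolding j using ceiling_correct[of y] by auto
  then have "x \<in> cell N j" "real j < real N"
    using assms y by (auto simp: cell_def y_def field_simps)
  then show thesis using that by auto
qed

lemma sum_indicator_cells: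
  assumes "N \<ge> 1"
  shows "(\<Sum>j<N. indicator (cell N j) x :: ennreal) = indicator {-1<..1} x"
proof (cases "x \<in> {-1<..1}")
  case True
  with assms obtain j where j: "j < N" "x \<in> cell N j" using cell_cover by blast
  then have "(\<Sum>j<N. indicator (cell N j) x :: ennreal) = (\<Sum>i\<in>{j}. indicator (cell N i) x)"
    by (intro sum.mono_neutral_right) (auto simp: indicator_def dest: cell_unique)
  then show ?thesis using j True by simp
next
  case False
  then have "x \<notin> cell N j" if "j < N" for j using cell_subset[OF that] that by auto
  then show ?thesis using False by (simp add: indicator_def)
qed

definition cell_mass :: "(real \<Rightarrow> real) \<Rightarrow> nat \<Rightarrow> nat \<Rightarrow> real" where
  "cell_mass u N j = (LINT x:cell N j|lebesgue. u x)"

text \<open>The factor N / 2 is the reciprocal of the length of a cell.\<close>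

definition cell_average :: "(real \<Rightarrow> real) \<Rightarrow> nat \<Rightarrow> nat \<Rightarrow> real" where
  "cell_average u N j = cell_mass u N j * (real N / 2)"

lemma cell_average_mass:
  fixes j N :: nat
  assumes "N \<ge> 1"
  defines "a \<equiv> -1 + 2 * real j / real N" and "b \<equiv> -1 + 2 * (real j + 1) / real N"
  shows "cell_average u N j = mass u a b / (b - a)"
proof -
  have "b - a = 2 / real N" by (simp add: a_def b_def diff_divide_distrib[symmetric])
  then show ?thesis
    by (simp add: cell_average_def cell_mass_def mass_def cell_def a_def b_def)
qed

text \<open>Growth is applied to cell j inside the smallest block of consecutive cells that contains
  j and k. The block is 1 + |j - k| cells long, which gives the base of the power. Density is
  applied to each cell itself.\<close>

lemma regular_weight_cells:
  assumes "regular_weight u"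
  obtains K \<tau> \<eta> :: real and s :: nat where "K > 0" "\<tau> > 0" "\<eta> > 0"
    "\<And>N j k. \<lbrakk>j < N; k < N\<rbrakk> \<Longrightarrow>
      cell_average u N k \<le> K * (1 + \<bar>real j - real k\<bar>) ^ s * cell_average u N j"
    "\<And>N j. j < N \<Longrightarrow> \<tau> * (2 / real N) \<le> measure lebesgue {x\<in>cell N j. \<eta> * cell_average u N j \<le> u x}"
proof -
  have wt: "weight u" using assms by (simp add: regular_weight_def)
  obtain K s where K: "K > 0" and growth: "\<And>a' a b b'. -1 \<le> a' \<Longrightarrow> a' \<le> a \<Longrightarrow> a < b \<Longrightarrow> b \<le> b' \<Longrightarrow> b' \<le> 1 \<Longrightarrow>
        mass u a' b' \<le> K * ((b' - a') / (b - a)) ^ s * mass u a b"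
    using assms unfolding regular_weight_def by blast
  obtain \<tau> \<eta> where \<tau>: "\<tau> > 0" "\<eta> > 0" and dens: "\<And>a b. -1 \<le> a \<Longrightarrow> a < b \<Longrightarrow> b \<le> 1 \<Longrightarrow>
        \<tau> * (b - a) \<le> measure lebesgue {x\<in>{a<..b}. \<eta> * (mass u a b / (b - a)) \<le> u x}"
    using assms unfolding regular_weight_def by blast
  show thesis
  proof (rule that[OF K \<tau>])
    fix N j k :: nat assume jk: "j < N" "k < N"
    define e where "e = (\<lambda>i. -1 + 2 * real i / real N)"
    have e_mono: "e i \<le> e i'" if "i \<le> i'" for i i' using that jk by (auto simp: e_def field_simps)
    have e_strict: "e i < e (Suc i)" for i using jk by (auto simp: e_def field_simps)
    have e_diff: "e i' - e i = (real i' - real i) * (2 / real N)" for i i'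
      using jk by (simp add: e_def field_simps)
    have e1: "e i \<le> 1" if "i \<le> N" for i using that jk by (auto simp: e_def field_simps)
    have e0: "-1 \<le> e i" for i by (simp add: e_def)
    have cm: "cell_mass u N i = mass u (e i) (e (Suc i))" for i
      by (simp add: cell_mass_def mass_def cell_def e_def add.commute)
    define a' b' where "a' = min j k" and "b' = Suc (max j k)"
    have "real b' - real a' = 1 + \<bar>real j - real k\<bar>" by (auto simp: a'_def b'_def)
    then have ratio: "(e b' - e a') / (e (Suc j) - e j) = 1 + \<bar>real j - real k\<bar>"
      using jk by (simp add: e_diff)
    have "mass u (e k) (e (Suc k)) \<le> mass u (e a') (e b')"
      unfolding mass_def
    proof (rule weight_integral_mono[OF wt])
      show "{e k<..e (Suc k)} \<subseteq> {e a'<..e b'}"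
        using e_mono[of a' k] e_mono[of "Suc k" b'] by (auto simp: a'_def b'_def)
      show "{e a'<..e b'} \<subseteq> {-1..1}"
        using e0[of a'] e1[of b'] jk by (fastforce simp: b'_def)
    qed auto
    also have "\<dots> \<le> K * ((e b' - e a') / (e (Suc j) - e j)) ^ s * mass u (e j) (e (Suc j))"
      by (intro growth e0 e1 e_mono e_strict) (use jk in \<open>auto simp: a'_def b'_def\<close>)
    finally have "cell_mass u N k \<le> K * (1 + \<bar>real j - real k\<bar>) ^ s * cell_mass u N j"
      unfolding ratio cm .
    then have "cell_mass u N k * (real N / 2) \<le> (K * (1 + \<bar>real j - real k\<bar>) ^ s * cell_mass u N j) * (real N / 2)"
      by (intro mult_right_mono) auto
    then show "cell_average u N k \<le> K * (1 + \<bar>real j - real k\<bar>) ^ s * cell_average u N j"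
      by (simp only: cell_average_def mult.assoc)
  next
    fix N j :: nat assume j: "j < N"
    define a b where "a = -1 + 2 * real j / real N" and "b = -1 + 2 * (real j + 1) / real N"
    have ba: "b - a = 2 / real N" by (simp add: a_def b_def diff_divide_distrib[symmetric])
    have avg: "cell_average u N j = mass u a b / (b - a)"
      unfolding a_def b_def using j by (intro cell_average_mass) auto
    have "-1 \<le> a" "b \<le> 1" using j by (auto simp: a_def b_def field_simps)
    moreover have "a < b" using ba j by (smt (verit) of_nat_0_less_iff zero_less_divide_iff not_less_zero gr0I)
    ultimately have "\<tau> * (b - a) \<le> measure lebesgue {x\<in>{a<..b}. \<eta> * (mass u a b / (b - a)) \<le> u x}"
      by (intro dens)
    moreover have "{a<..b} = cell N j" by (simp add: cell_def a_def b_def)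
    ultimately show "\<tau> * (2 / real N) \<le> measure lebesgue {x\<in>cell N j. \<eta> * cell_average u N j \<le> u x}"
      by (simp only: ba avg)
  qed
qed

lemma cell_average_nonneg:
  assumes "weight u" "j < N" shows "0 \<le> cell_average u N j"
  unfolding cell_average_def cell_mass_def using assms cell_subset[OF assms(2)]
  by (intro mult_nonneg_nonneg weight_integral_nonneg) auto

text \<open>A Chebyshev-type bound: the integral is restricted to the superlevel set of u, where f
  is at least A.\<close>

lemma superlevel_integral_bound:
  fixes f :: "real \<Rightarrow> real"
  assumes wt: "weight u" and j: "j < N" and \<tau>: "0 \<le> \<tau>"
    and dens: "\<tau> * (2 / real N) \<le> measure lebesgue {y\<in>cell N j. c \<le> u y}"
    and le: "\<And>y. y \<in> cell N j \<Longrightarrow> c \<le> u y \<Longrightarrow> A \<le> f y" and A: "0 \<le> A"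
  shows "ennreal (A * (\<tau> * (2 / real N))) \<le> (\<integral>\<^sup>+y\<in>cell N j. ennreal (f y) \<partial>lebesgue)"
proof -
  define E where "E = {y\<in>cell N j. c \<le> u y}"
  have E: "E \<in> lmeasurable"
    unfolding E_def cell_def using j by (intro weight_superlevel[OF wt]) (auto simp: field_simps)
  have "ennreal (A * (\<tau> * (2 / real N))) \<le> ennreal (A * measure lebesgue E)"
    using dens A unfolding E_def by (intro ennreal_leI mult_left_mono)
  also have "\<dots> = ennreal A * emeasure lebesgue E"
    using E A by (simp add: ennreal_mult emeasure_eq_ennreal_measure fmeasurable_def less_top)
  also have "\<dots> = (\<integral>\<^sup>+y. ennreal A * indicator E y \<partial>lebesgue)"
    using E by (intro nn_integral_cmult_indicator[symmetric]) auto
  also have "\<dots> \<le> (\<integral>\<^sup>+y\<in>cell N j. ennreal (f y) \<partial>lebesgue)"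
    by (intro nn_integral_mono) (auto simp: E_def indicator_def intro!: ennreal_leI le)
  finally show ?thesis .
qed

section \<open>The weighted estimate from cell to cell\<close>

text \<open>The decay in the distance of the cells from \<open>one_sided_local_bound\<close>
  outweighs the growth of the cell averages, and w loses only a constant from x to cell j. On a
  fixed proportion of that cell the average is replaced by u, and integrating over this part
  produces the factor N.\<close>

lemma weighted_cell_bound:
  fixes p r :: real
  assumes u: "regular_weight u" and p: "p > 0" and r: "r > 0"
    and out: "\<And>y. y \<in> {-1..1} \<Longrightarrow> increasing_outward {-1..1} w y"
    and nonneg: "\<And>x. x \<in> {-1..1} \<Longrightarrow> 0 \<le> w x"
  obtains K :: nat and C :: real where "K \<ge> 1" "C > 0"
    "\<And>n (P :: real poly) k x. \<lbrakk>n \<ge> 1; degree P \<le> n; k < K * n\<^sup>2; x \<in> cell (K * n\<^sup>2) k\<rbrakk> \<Longrightarrow>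
      \<exists>j<K * n\<^sup>2. ennreal (\<bar>poly P x\<bar> powr p * (w x * cell_average u (K * n\<^sup>2) k) powr r) \<le>
        ennreal (C * real (K * n\<^sup>2) / (1 + \<bar>real j - real k\<bar>)\<^sup>2) *
        (\<integral>\<^sup>+y\<in>cell (K * n\<^sup>2) j. ennreal (\<bar>poly P y\<bar> powr p * (w y * u y) powr r) \<partial>lebesgue)"
proof -
  have wt: "weight u" using u by (simp add: regular_weight_def)
  obtain \<delta> c where \<delta>: "\<delta> > 0" and c: "c > 0" and
    side: "\<And>x. x \<in> {-1..1} \<Longrightarrow> \<exists>\<sigma>. \<bar>\<sigma>\<bar> = 1 \<and> x + \<sigma> * \<delta> \<in> {-1..1} \<and>
       (\<forall>y. 0 \<le> \<sigma> * (y - x) \<and> \<sigma> * (y - x) \<le> \<delta> \<longrightarrow> c * w x \<le> w y)"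
    using uniform_increasing_side[OF out nonneg] by metis
  obtain K1 \<tau> \<eta> s where K1: "K1 > 0" and \<tau>: "\<tau> > 0" and \<eta>: "\<eta> > 0" and
    growth: "\<And>N j k. j < N \<Longrightarrow> k < N \<Longrightarrow>
      cell_average u N k \<le> K1 * (1 + \<bar>real j - real k\<bar>) ^ s * cell_average u N j" and
    dens: "\<And>N j. j < N \<Longrightarrow> \<tau> * (2 / real N) \<le> measure lebesgue {x\<in>cell N j. \<eta> * cell_average u N j \<le> u x}"
    by (rule regular_weight_cells[OF u]) (rule that; blast)
  \<comment> \<open>With m p >= s r + 2 the decay to the power p absorbs the growth to the power r
    and still leaves the exponent -2.\<close>
  define m where "m = nat \<lceil>(real s * r + 2) / p\<rceil>"
  have "(real s * r + 2) / p \<le> real m" unfolding m_def by (rule real_nat_ceiling_ge)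
  then have m: "real s * r + 2 \<le> real m * p" using p by (simp add: field_simps)
  obtain K :: nat and C0 where K: "K \<ge> 1" and C0: "C0 > 0" and
    loc: "\<And>n (P :: real poly) k x \<sigma>. n \<ge> 1 \<Longrightarrow> degree P \<le> n \<Longrightarrow> k < K * n\<^sup>2 \<Longrightarrow> x \<in> cell (K * n\<^sup>2) k \<Longrightarrow>
        \<bar>\<sigma>\<bar> = 1 \<Longrightarrow> x + \<sigma> * \<delta> \<in> {-1..1} \<Longrightarrow>
      \<exists>j<K * n\<^sup>2. \<forall>y\<in>cell (K * n\<^sup>2) j. 0 \<le> \<sigma> * (y - x) \<and> \<sigma> * (y - x) \<le> \<delta> \<and>
        \<bar>poly P x\<bar> \<le> C0 * (1 / (1 + \<bar>real j - real k\<bar>)) ^ m * \<bar>poly P y\<bar>"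
    by (rule one_sided_local_bound[OF \<delta>, of m]) (rule that; blast)
  define \<kappa> where "\<kappa> = K1 / (c * \<eta>)"
  have \<kappa>: "\<kappa> > 0" using K1 c \<eta> by (simp add: \<kappa>_def)
  define C1 where "C1 = C0 powr p * \<kappa> powr r"
  have C1: "C1 > 0" unfolding C1_def using C0 \<kappa> by simp
  show thesis
  \<comment> \<open>Dividing by \<open>2 * \<tau>\<close> and multiplying by N cancels the lower
    bound \<open>\<tau> * (2 / N)\<close> for the measure of the superlevel set.\<close>
  proof (rule that[OF K, of "C1 / (2 * \<tau>)"])
    show "C1 / (2 * \<tau>) > 0" using C1 \<tau> by simp
    fix n k :: nat and P :: "real poly" and x :: real
    assume n: "n \<ge> 1" and deg: "degree P \<le> n" and k: "k < K * n\<^sup>2" and x: "x \<in> cell (K * n\<^sup>2) k"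
    define N where "N = K * n\<^sup>2"
    have x1: "x \<in> {-1..1}" using cell_subset[OF k] x by auto
    obtain \<sigma> where \<sigma>: "\<bar>\<sigma>\<bar> = 1" "x + \<sigma> * \<delta> \<in> {-1..1}" and
      w_le: "\<And>y. 0 \<le> \<sigma> * (y - x) \<Longrightarrow> \<sigma> * (y - x) \<le> \<delta> \<Longrightarrow> c * w x \<le> w y"
      using side[OF x1] by blast
    obtain j where j: "j < N" and jP: "\<And>y. y \<in> cell N j \<Longrightarrow> 0 \<le> \<sigma> * (y - x) \<and> \<sigma> * (y - x) \<le> \<delta> \<and>
        \<bar>poly P x\<bar> \<le> C0 * (1 / (1 + \<bar>real j - real k\<bar>)) ^ m * \<bar>poly P y\<bar>"
      using loc[OF n deg k x \<sigma>] unfolding N_def by blast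
    define Z where "Z = 1 + \<bar>real j - real k\<bar>"
    have Z: "Z \<ge> 1" by (simp add: Z_def)
    define f where "f = (\<lambda>y. \<bar>poly P y\<bar> powr p * (w y * u y) powr r)"
    define A where "A = \<bar>poly P x\<bar> powr p * (w x * cell_average u N k) powr r"
    have A0: "0 \<le> A" by (simp add: A_def)
    have avg_nonneg: "0 \<le> cell_average u N i" if "i < N" for i
      using cell_average_nonneg[OF wt that] .
    have bound: "Z\<^sup>2 / C1 * A \<le> f y" if y: "y \<in> cell N j" "\<eta> * cell_average u N j \<le> u y" for y
    proof -
      have y1: "y \<in> {-1..1}" using cell_subset[OF j] y(1) by auto
      have uy: "0 \<le> u y" using wt y1 by (simp add: weight_def)
      have wxy: "w x \<le> w y / c" using w_le[of y] jP[OF y(1)] c by (simp add: field_simps)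
      have "cell_average u N k \<le> K1 * Z ^ s * cell_average u N j"
        using growth[OF j] k unfolding N_def Z_def by simp
      also have "\<dots> \<le> K1 * Z ^ s * (u y / \<eta>)"
        using y(2) \<eta> K1 Z by (intro mult_left_mono) (auto simp: field_simps)
      finally have "w x * cell_average u N k \<le> (w y / c) * (K1 * Z ^ s * (u y / \<eta>))"
        using wxy nonneg[OF x1] nonneg[OF y1] c k by (intro mult_mono avg_nonneg) (auto simp: N_def)
      also have "\<dots> = \<kappa> * Z ^ s * (w y * u y)" by (simp add: \<kappa>_def)
      finally have "(w x * cell_average u N k) powr r \<le> (\<kappa> * Z ^ s * (w y * u y)) powr r"
        using r nonneg[OF x1] k by (intro powr_mono2 mult_nonneg_nonneg avg_nonneg) (auto simp: N_def)
      also have "\<dots> = \<kappa> powr r * Z powr (real s * r) * (w y * u y) powr r"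
        using \<kappa> Z uy nonneg[OF y1] by (simp add: powr_mult powr_powr flip: powr_realpow)
      finally have 1: "(w x * cell_average u N k) powr r \<le> \<kappa> powr r * Z powr (real s * r) * (w y * u y) powr r" .
      have "\<bar>poly P x\<bar> powr p \<le> (C0 * (1 / Z) ^ m * \<bar>poly P y\<bar>) powr p"
        using jP[OF y(1)] p unfolding Z_def by (intro powr_mono2) auto
      also have "(1 / Z) ^ m = Z powr (- real m)"
        using Z by (simp add: powr_minus powr_realpow power_inverse divide_inverse)
      also have "(C0 * Z powr (- real m) * \<bar>poly P y\<bar>) powr p = C0 powr p * Z powr (- (real m * p)) * \<bar>poly P y\<bar> powr p"
        using C0 by (simp add: powr_mult powr_powr)
      finally have "A \<le> (C0 powr p * Z powr (- (real m * p)) * \<bar>poly P y\<bar> powr p) *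
          (\<kappa> powr r * Z powr (real s * r) * (w y * u y) powr r)"
        unfolding A_def using 1 by (intro mult_mono) auto
      also have "\<dots> = C1 * (Z powr (- (real m * p)) * Z powr (real s * r)) * f y"
        by (simp add: C1_def f_def mult_ac)
      also have "Z powr (- (real m * p)) * Z powr (real s * r) = Z powr (real s * r - real m * p)"
        by (simp add: powr_add[symmetric])
      also have "C1 * Z powr (real s * r - real m * p) * f y \<le> C1 * Z powr (- 2) * f y"
        using m Z C1 by (intro mult_right_mono mult_left_mono powr_mono) (auto simp: f_def)
      also have "Z powr (- 2) = 1 / Z\<^sup>2" using Z by (simp add: powr_minus divide_inverse)
      finally have "A \<le> C1 * (1 / Z\<^sup>2) * f y" .
      then show ?thesis using C1 Z by (simp add: field_simps)
    qed
    have "ennreal A = ennreal (C1 / (2 * \<tau>) * real N / Z\<^sup>2) * ennreal (Z\<^sup>2 / C1 * A * (\<tau> * (2 / real N)))"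
      using C1 \<tau> Z j A0 by (subst ennreal_mult[symmetric]) (auto simp: field_simps)
    also have "\<dots> \<le> ennreal (C1 / (2 * \<tau>) * real N / Z\<^sup>2) * (\<integral>\<^sup>+y\<in>cell N j. ennreal (f y) \<partial>lebesgue)"
      using \<tau> C1 A0 by (intro mult_left_mono superlevel_integral_bound[OF wt j _ dens[OF j] bound]) auto
    finally show "\<exists>j<K * n\<^sup>2. ennreal (\<bar>poly P x\<bar> powr p * (w x * cell_average u (K * n\<^sup>2) k) powr r) \<le>
        ennreal (C1 / (2 * \<tau>) * real (K * n\<^sup>2) / (1 + \<bar>real j - real k\<bar>)\<^sup>2) *
        (\<integral>\<^sup>+y\<in>cell (K * n\<^sup>2) j. ennreal (\<bar>poly P y\<bar> powr p * (w y * u y) powr r) \<partial>lebesgue)"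
      unfolding A_def f_def N_def[symmetric] Z_def using j by blast
  qed
qed

text \<open>A bound uniform in j and N is wanted; the term - 1 / (1 + j) carries the induction on j.
  A shift of the index adds one summand, which is at most 1 / (1 + j) - 1 / (2 + j).\<close>

lemma sum_inverse_squares_le:
  "(\<Sum>k<N. 1 / (1 + \<bar>real j - real k\<bar>)\<^sup>2) \<le> 4 - 1 / (1 + real j)"
proof (induction j arbitrary: N)
  case 0
  have "(\<Sum>k<N. 1 / (1 + real k)\<^sup>2) \<le> 2 - 2 / (1 + real N)"
  proof (induction N)
    case (Suc N)
    have "(1 + real N) * (2 + real N) \<le> 2 * (1 + real N)\<^sup>2"
      by (simp add: power2_eq_square algebra_simps)
    then have "1 / (1 + real N)\<^sup>2 \<le> 2 / ((1 + real N) * (2 + real N))"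
      by (simp add: divide_le_eq le_divide_eq add_pos_nonneg)
    also have "\<dots> = 2 / (1 + real N) - 2 / (2 + real N)"
      by (simp add: field_simps add_nonneg_eq_0_iff)
    finally show ?case using Suc by simp
  qed simp
  also have "\<dots> \<le> 3" by (simp add: field_simps)
  finally show ?case by simp
next
  case (Suc j)
  show ?case
  proof (cases N)
    case (Suc M)
    have "(\<Sum>k<N. 1 / (1 + \<bar>real (Suc j) - real k\<bar>)\<^sup>2) =
      1 / (2 + real j)\<^sup>2 + (\<Sum>k<M. 1 / (1 + \<bar>real j - real k\<bar>)\<^sup>2)"
      unfolding Suc by (subst sum.lessThan_Suc_shift) simp
    also have "1 / (2 + real j)\<^sup>2 \<le> 1 / ((1 + real j) * (2 + real j))"
      unfolding power2_eq_square by (intro divide_left_mono mult_right_mono mult_pos_pos) auto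
    also have "(\<Sum>k<M. 1 / (1 + \<bar>real j - real k\<bar>)\<^sup>2) \<le> 4 - 1 / (1 + real j)"
      by (rule Suc.IH)
    also have "1 / ((1 + real j) * (2 + real j)) = 1 / (1 + real j) - 1 / (2 + real j)"
      by (simp add: field_simps add_nonneg_eq_0_iff)
    finally show ?thesis by simp
  qed (simp add: field_simps)
qed

lemma weight_nn_integral:
  assumes "weight u" "A \<in> sets lebesgue" "A \<subseteq> {-1..1}"
  shows "(\<integral>\<^sup>+x\<in>A. ennreal (u x) \<partial>lebesgue) = ennreal (LINT x:A|lebesgue. u x)"
proof -
  have "(\<integral>\<^sup>+x\<in>A. ennreal (u x) \<partial>lebesgue) = (\<integral>\<^sup>+x. ennreal (indicat_real A x *\<^sub>R u x) \<partial>lebesgue)"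
    by (intro nn_integral_cong) (auto simp: indicator_def)
  also have "\<dots> = ennreal (LINT x:A|lebesgue. u x)"
    unfolding set_lebesgue_integral_def using weight_integrable[OF assms] assms
    by (intro nn_integral_eq_integral) (auto simp: set_integrable_def weight_def indicator_def)
  finally show ?thesis .
qed

lemma product_weight_measurable:
  assumes "weight u" "continuous_on {-1..1} w"
  shows "(\<lambda>x. indicat_real {-1..1} x * (w x * u x)) \<in> borel_measurable lebesgue"
proof -
  have "(\<lambda>x. indicat_real {-1..1} x *\<^sub>R w x) \<in> borel_measurable borel"
    using assms(2) by (intro borel_measurable_continuous_on_indicator) auto
  then have "(\<lambda>x. indicat_real {-1..1} x *\<^sub>R w x) \<in> borel_measurable lebesgue"
    by (simp add: measurable_completion)
  then have "(\<lambda>x. (indicat_real {-1..1} x *\<^sub>R w x) * (indicat_real {-1..1} x * u x)) \<in> borel_measurable lebesgue"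
    using weight_measurable[OF assms(1)] by (rule borel_measurable_times)
  moreover have "(\<lambda>x. (indicat_real {-1..1} x *\<^sub>R w x) * (indicat_real {-1..1} x * u x)) =
      (\<lambda>x. indicat_real {-1..1} x * (w x * u x))"
    by (auto simp: indicator_def)
  ultimately show ?thesis by simp
qed

lemma poly_borel_measurable: "poly P \<in> borel_measurable lebesgue" for P :: "real poly"
proof -
  have "poly P \<in> borel_measurable borel"
    by (intro borel_measurable_continuous_onI continuous_intros)
  then show ?thesis by (simp add: measurable_completion)
qed

lemma weighted_poly_measurable:
  fixes P :: "real poly"
  assumes "weight u" "continuous_on {-1..1} w"
  shows "(\<lambda>x. ennreal (\<bar>poly P x\<bar> powr p * (w x * u x) powr r) * indicator {-1..1} x) \<in> borel_measurable lebesgue"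
    "(\<lambda>x. ennreal (\<bar>poly P x\<bar> powr p * (w x * u x)) * indicator {-1..1} x) \<in> borel_measurable lebesgue"
proof -
  note [measurable] = product_weight_measurable[OF assms] poly_borel_measurable[of P]
  have [measurable]: "{-1..1::real} \<in> sets lebesgue" by simp
  have "(\<lambda>x. ennreal (\<bar>poly P x\<bar> powr p * (indicat_real {-1..1} x * (w x * u x)) powr r) * indicator {-1..1} x) \<in> borel_measurable lebesgue"
    by measurable
  then show "(\<lambda>x. ennreal (\<bar>poly P x\<bar> powr p * (w x * u x) powr r) * indicator {-1..1} x) \<in> borel_measurable lebesgue"
    by (rule back_subst[where P = "\<lambda>f. f \<in> borel_measurable lebesgue"]) (auto simp: indicator_def)
  have "(\<lambda>x. ennreal (\<bar>poly P x\<bar> powr p * (indicat_real {-1..1} x * (w x * u x))) * indicator {-1..1} x) \<in> borel_measurable lebesgue"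
    by measurable
  then show "(\<lambda>x. ennreal (\<bar>poly P x\<bar> powr p * (w x * u x)) * indicator {-1..1} x) \<in> borel_measurable lebesgue"
    by (rule back_subst[where P = "\<lambda>f. f \<in> borel_measurable lebesgue"]) (auto simp: indicator_def)
qed

lemma nn_integral_cells:
  fixes f :: "real \<Rightarrow> ennreal"
  assumes f: "(\<lambda>x. f x * indicator {-1..1} x) \<in> borel_measurable lebesgue" and N: "N \<ge> 1"
  shows "(\<integral>\<^sup>+x\<in>{-1..1}. f x \<partial>lebesgue) = (\<Sum>k<N. \<integral>\<^sup>+x\<in>cell N k. f x \<partial>lebesgue)"
proof -
  define g where "g = (\<lambda>x. f x * indicator {-1..1} x)"
  have g: "g \<in> borel_measurable lebesgue" unfolding g_def by (rule f)
  have cm: "cell N k \<in> sets lebesgue" for k by (simp add: cell_def)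
  have "(\<Sum>k<N. \<integral>\<^sup>+x\<in>cell N k. f x \<partial>lebesgue) = (\<Sum>k<N. \<integral>\<^sup>+x. g x * indicator (cell N k) x \<partial>lebesgue)"
  proof (intro sum.cong nn_integral_cong)
    fix k x assume "k \<in> {..<N}"
    then have "cell N k \<subseteq> {-1<..1}" by (intro cell_subset) auto
    then show "f x * indicator (cell N k) x = g x * indicator (cell N k) x"
      by (auto simp: g_def indicator_def)
  qed simp
  also have "\<dots> = (\<integral>\<^sup>+x. (\<Sum>k<N. g x * indicator (cell N k) x) \<partial>lebesgue)"
    using g cm by (intro nn_integral_sum[symmetric]) auto
  also have "\<dots> = (\<integral>\<^sup>+x. g x * indicator {-1<..1} x \<partial>lebesgue)"
    by (simp add: sum_distrib_left[symmetric] sum_indicator_cells[OF N])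
  also have "\<dots> = (\<integral>\<^sup>+x. g x \<partial>lebesgue)"
  proof (rule nn_integral_cong_AE)
    \<comment> \<open>The only point of [-1, 1] outside all cells is -1, a null set.\<close>
    have "AE x in lebesgue. x \<noteq> (-1::real)"
      by (rule AE_completion) (rule AE_lborel_singleton)
    then show "AE x in lebesgue. g x * indicator {-1<..1} x = g x"
      by eventually_elim (auto simp: g_def indicator_def)
  qed
  finally show ?thesis by (simp add: g_def)
qed

lemma square_powr:
  fixes x :: real
  assumes "0 < x"
  shows "x\<^sup>2 powr a = x powr (2 * a)"
  using assms powr_powr[of x 2 a] by simp

section \<open>From cells to norms\<close>

text \<open>With t = q / p, the k-th cell contributes a multiple of \<open>G k powr t\<close>. Each
  \<open>G k\<close> is at most x and their sum is at most 4 x, so the sum of the powers is at most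
  \<open>4 * x powr t\<close>. Finiteness is assumed because \<open>enn2real\<close> sends infinity
  to 0.\<close>

lemma nikolskii_integral:
  fixes p q :: real
  assumes u: "regular_weight u" and w: "continuous_on {-1..1} w" and pq: "0 < p" "p \<le> q"
    and out: "\<And>y. y \<in> {-1..1} \<Longrightarrow> increasing_outward {-1..1} w y"
    and nonneg: "\<And>x. x \<in> {-1..1} \<Longrightarrow> 0 \<le> w x"
  shows "\<exists>D>0. \<forall>n\<ge>1. \<forall>P :: real poly. degree P \<le> n \<longrightarrow>
      (\<integral>\<^sup>+x\<in>{-1..1}. ennreal (\<bar>poly P x\<bar> powr p * (w x * u x) powr (p / q)) \<partial>lebesgue) \<noteq> \<infinity> \<longrightarrow>
      (\<integral>\<^sup>+x\<in>{-1..1}. ennreal (\<bar>poly P x\<bar> powr q * (w x * u x)) \<partial>lebesgue) \<le>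
      ennreal (D * (real n)\<^sup>2 powr (q / p - 1) *
        enn2real (\<integral>\<^sup>+x\<in>{-1..1}. ennreal (\<bar>poly P x\<bar> powr p * (w x * u x) powr (p / q)) \<partial>lebesgue) powr (q / p))"
proof -
  have wt: "weight u" using u by (simp add: regular_weight_def)
  define t where "t = q / p"
  have t: "t \<ge> 1" using pq by (simp add: t_def)
  have r: "0 < p / q" using pq by simp
  obtain K :: nat and C where K: "K \<ge> 1" and C: "C > 0" and bound:
    "\<And>n (P :: real poly) k x. \<lbrakk>n \<ge> 1; degree P \<le> n; k < K * n\<^sup>2; x \<in> cell (K * n\<^sup>2) k\<rbrakk> \<Longrightarrow>
      \<exists>j<K * n\<^sup>2. ennreal (\<bar>poly P x\<bar> powr p * (w x * cell_average u (K * n\<^sup>2) k) powr (p / q)) \<le>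
        ennreal (C * real (K * n\<^sup>2) / (1 + \<bar>real j - real k\<bar>)\<^sup>2) *
        (\<integral>\<^sup>+y\<in>cell (K * n\<^sup>2) j. ennreal (\<bar>poly P y\<bar> powr p * (w y * u y) powr (p / q)) \<partial>lebesgue)"
    by (rule weighted_cell_bound[OF u pq(1) r out nonneg]) (assumption, assumption, (rule that; blast))
  \<comment> \<open>The constant 8 is 4 from the inverse squares times 2 from the cell length 2 / N;
    the power of K comes from \<open>N = K n\<^sup>2\<close>.\<close>
  define D where "D = 8 * C powr t * real K powr (t - 1)"
  have D: "D > 0" unfolding D_def using C K by simp
  show ?thesis
    unfolding t_def[symmetric]
  proof (intro exI[of _ D] conjI D allI impI)
    fix n :: nat and P :: "real poly"
    assume n: "1 \<le> n" and deg: "degree P \<le> n"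
    define N where "N = K * n\<^sup>2"
    have N: "N \<ge> 1" using K n by (simp add: N_def)
    define X where "X = (\<integral>\<^sup>+x\<in>{-1..1}. ennreal (\<bar>poly P x\<bar> powr p * (w x * u x) powr (p / q)) \<partial>lebesgue)"
    define Xj where "Xj = (\<lambda>j. \<integral>\<^sup>+x\<in>cell N j. ennreal (\<bar>poly P x\<bar> powr p * (w x * u x) powr (p / q)) \<partial>lebesgue)"
    assume "X \<noteq> \<infinity>"
    have X_sum: "X = (\<Sum>j<N. Xj j)"
      unfolding X_def Xj_def using N by (intro nn_integral_cells weighted_poly_measurable wt w)
    have Xj_le: "Xj j \<le> X" if "j < N" for j
      unfolding X_sum using that by (intro member_le_sum) auto
    define x where "x = enn2real X"
    define xj where "xj = (\<lambda>j. enn2real (Xj j))"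
    have xj: "Xj j = ennreal (xj j)" if "j < N" for j
      using Xj_le[OF that] \<open>X \<noteq> \<infinity>\<close> by (simp add: xj_def less_top neq_top_trans)
    have xj0: "0 \<le> xj j" for j by (simp add: xj_def)
    have "X = ennreal (\<Sum>j<N. xj j)"
      unfolding X_sum using xj xj0 by (simp add: sum_ennreal)
    then have x_sum: "x = (\<Sum>j<N. xj j)" unfolding x_def using xj0 by (simp add: sum_nonneg)
    have x0: "0 \<le> x" by (simp add: x_def)
    \<comment> \<open>The index j of the local estimate varies with the point; summing over all j
      covers every choice and leaves a bound that depends on the cell only.\<close>
    define G where "G = (\<lambda>k. \<Sum>j<N. xj j * (1 / (1 + \<bar>real j - real k\<bar>)\<^sup>2))"
    have G0: "0 \<le> G k" for k unfolding G_def using xj0 by (intro sum_nonneg mult_nonneg_nonneg) auto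
    have G_le: "G k \<le> x" for k
      unfolding G_def x_sum
    proof (rule sum_mono)
      fix j
      have "1 / (1 + \<bar>real j - real k\<bar>)\<^sup>2 \<le> 1" by (simp add: divide_le_eq_1)
      then show "xj j * (1 / (1 + \<bar>real j - real k\<bar>)\<^sup>2) \<le> xj j"
        using mult_left_mono[OF _ xj0[of j], of "1 / (1 + \<bar>real j - real k\<bar>)\<^sup>2" 1] by simp
    qed
    have "(\<Sum>k<N. G k) = (\<Sum>j<N. xj j * (\<Sum>k<N. 1 / (1 + \<bar>real j - real k\<bar>)\<^sup>2))"
      unfolding G_def by (subst sum.swap) (simp add: sum_distrib_left)
    also have "\<dots> \<le> (\<Sum>j<N. xj j * 4)"
    proof (intro sum_mono mult_left_mono xj0)
      fix j
      have "0 \<le> 1 / (1 + real j)" by simp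
      then show "(\<Sum>k<N. 1 / (1 + \<bar>real j - real k\<bar>)\<^sup>2) \<le> 4"
        using sum_inverse_squares_le[of j N] by linarith
    qed
    finally have G_sum: "(\<Sum>k<N. G k) \<le> 4 * x"
      unfolding x_sum sum_distrib_left by (simp add: mult.commute)
    define B where "B = (\<lambda>k. (C * real N * G k) powr t)"
    have pw: "\<bar>poly P y\<bar> powr q * (w y * cell_average u N k) \<le> B k" if k: "k < N" and y: "y \<in> cell N k" for k y
    proof -
      have y1: "y \<in> {-1..1}" using cell_subset[OF k] y by auto
      have wm: "0 \<le> w y * cell_average u N k"
        by (intro mult_nonneg_nonneg nonneg y1 cell_average_nonneg[OF wt k])
      define A where "A = \<bar>poly P y\<bar> powr p * (w y * cell_average u N k) powr (p / q)"
      obtain j where j: "j < N" "ennreal A \<le> ennreal (C * real N / (1 + \<bar>real j - real k\<bar>)\<^sup>2) * Xj j"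
        using bound[OF n deg, of k y] k y unfolding N_def[symmetric] A_def Xj_def by blast
      have "ennreal A \<le> ennreal (C * real N / (1 + \<bar>real j - real k\<bar>)\<^sup>2 * xj j)"
        using j(2) C xj0[of j] unfolding xj[OF j(1)] by (subst ennreal_mult) auto
      then have "A \<le> C * real N / (1 + \<bar>real j - real k\<bar>)\<^sup>2 * xj j"
        using C xj0[of j] by (subst (asm) ennreal_le_iff) auto
      also have "\<dots> = C * real N * (xj j * (1 / (1 + \<bar>real j - real k\<bar>)\<^sup>2))" by simp
      also have "\<dots> \<le> C * real N * G k"
        unfolding G_def using C xj0 j(1) by (intro mult_left_mono member_le_sum) auto
      finally have "A powr t \<le> B k" unfolding B_def using t by (intro powr_mono2) (auto simp: A_def)
      moreover have "A powr t = \<bar>poly P y\<bar> powr q * (w y * cell_average u N k)"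
        unfolding A_def t_def using pq wm by (simp add: powr_mult powr_powr flip: abs_mult)
      ultimately show ?thesis by simp
    qed
    have cell_int: "(\<integral>\<^sup>+y\<in>cell N k. ennreal (\<bar>poly P y\<bar> powr q * (w y * u y)) \<partial>lebesgue) \<le> ennreal (B k * (2 / real N))"
      if k: "k < N" for k
    proof -
      have cs: "cell N k \<in> sets lebesgue" "cell N k \<subseteq> {-1..1}" using cell_subset[OF k] by (auto simp: cell_def)
      have u0: "0 \<le> u y" if "y \<in> cell N k" for y using wt cs that by (auto simp: weight_def)
      have um: "(\<lambda>y. ennreal (u y) * indicator (cell N k) y) \<in> borel_measurable lebesgue"
      proof -
        have "(\<lambda>y. ennreal (indicat_real (cell N k) y *\<^sub>R u y)) \<in> borel_measurable lebesgue"
          using weight_integrable[OF wt cs] unfolding set_integrable_def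
          by (intro measurable_compose[OF borel_measurable_integrable measurable_ennreal])
        then show ?thesis
          by (rule back_subst[where P = "\<lambda>f. f \<in> borel_measurable lebesgue"]) (auto simp: indicator_def)
      qed
      define a where "a = cell_average u N k"
      have int_u: "(\<integral>\<^sup>+y\<in>cell N k. ennreal (u y) \<partial>lebesgue) = ennreal (a * (2 / real N))"
        using weight_nn_integral[OF wt cs] N by (simp add: a_def cell_average_def cell_mass_def)
      show ?thesis
      \<comment> \<open>If the average is 0, then u vanishes almost everywhere on the cell.
        Otherwise the average is divided out of the pointwise bound and the integral of u brings it
        back.\<close>
      proof (cases "a = 0")
        case True
        then have "AE y in lebesgue. ennreal (u y) * indicator (cell N k) y = 0"
          using int_u um by (simp add: nn_integral_0_iff_AE)
        then have "AE y in lebesgue. ennreal (\<bar>poly P y\<bar> powr q * (w y * u y)) * indicator (cell N k) y = 0"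
        proof eventually_elim
          case (elim y)
          then show ?case using u0[of y] by (cases "y \<in> cell N k") (auto simp: ennreal_eq_0_iff)
        qed
        then have "(\<integral>\<^sup>+y\<in>cell N k. ennreal (\<bar>poly P y\<bar> powr q * (w y * u y)) \<partial>lebesgue) = (\<integral>\<^sup>+y. 0 \<partial>(lebesgue :: real measure))"
          by (rule nn_integral_cong_AE)
        then show ?thesis by simp
      next
        case False
        then have a: "0 < a" using cell_average_nonneg[OF wt k] by (simp add: a_def)
        have "(\<integral>\<^sup>+y\<in>cell N k. ennreal (\<bar>poly P y\<bar> powr q * (w y * u y)) \<partial>lebesgue) \<le>
          (\<integral>\<^sup>+y. ennreal (B k / a) * (ennreal (u y) * indicator (cell N k) y) \<partial>lebesgue)"
        proof (intro nn_integral_mono)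
          fix y
          show "ennreal (\<bar>poly P y\<bar> powr q * (w y * u y)) * indicator (cell N k) y \<le>
              ennreal (B k / a) * (ennreal (u y) * indicator (cell N k) y)"
          proof (cases "y \<in> cell N k")
            case True
            have "\<bar>poly P y\<bar> powr q * w y \<le> B k / a"
              using pw[OF k True] a by (simp add: a_def field_simps)
            then have "\<bar>poly P y\<bar> powr q * w y * u y \<le> B k / a * u y"
              by (intro mult_right_mono u0 True)
            then show ?thesis using True a u0[OF True]
              by (simp add: ennreal_mult[symmetric] B_def mult.assoc ennreal_leI)
          qed simp
        qed
        also have "\<dots> = ennreal (B k / a) * ennreal (a * (2 / real N))"
          using um by (subst nn_integral_cmult) (auto simp: int_u)
        also have "\<dots> = ennreal (B k * (2 / real N))"
          using a by (simp add: ennreal_mult[symmetric] B_def)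
        finally show ?thesis .
      qed
    qed
    \<comment> \<open>One factor \<open>G k\<close> is kept for the summation over k and the
      remaining power t - 1 is estimated by x.\<close>
    have B_le: "B k \<le> (C * real N) powr t * (G k * x powr (t - 1))" for k
    proof -
      have "G k powr t = G k * G k powr (t - 1)"
        using G0[of k] by (cases "G k = 0") (auto simp: powr_diff)
      also have "\<dots> \<le> G k * x powr (t - 1)"
        using G0 G_le t by (intro mult_left_mono powr_mono2) auto
      finally show ?thesis
        unfolding B_def using C G0[of k] by (subst powr_mult) (auto intro: mult_left_mono)
    qed
    have "(\<integral>\<^sup>+x\<in>{-1..1}. ennreal (\<bar>poly P x\<bar> powr q * (w x * u x)) \<partial>lebesgue) =
        (\<Sum>k<N. \<integral>\<^sup>+x\<in>cell N k. ennreal (\<bar>poly P x\<bar> powr q * (w x * u x)) \<partial>lebesgue)"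
      using N by (intro nn_integral_cells weighted_poly_measurable wt w)
    also have "\<dots> \<le> (\<Sum>k<N. ennreal (B k * (2 / real N)))" by (intro sum_mono cell_int) auto
    also have "\<dots> = ennreal (\<Sum>k<N. B k * (2 / real N))" by (intro sum_ennreal) (simp add: B_def)
    also have "\<dots> \<le> ennreal (D * (real n)\<^sup>2 powr (t - 1) * x powr t)"
    proof (rule ennreal_leI)
      have "(\<Sum>k<N. B k * (2 / real N)) \<le> (\<Sum>k<N. ((C * real N) powr t * x powr (t - 1) * (2 / real N)) * G k)"
      proof (rule sum_mono)
        fix k
        have "B k * (2 / real N) \<le> (C * real N) powr t * (G k * x powr (t - 1)) * (2 / real N)"
          by (intro mult_right_mono B_le) auto
        then show "B k * (2 / real N) \<le> ((C * real N) powr t * x powr (t - 1) * (2 / real N)) * G k"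
          by (simp add: mult_ac)
      qed
      also have "\<dots> = ((C * real N) powr t * x powr (t - 1) * (2 / real N)) * (\<Sum>k<N. G k)"
        by (simp add: sum_distrib_left)
      also have "\<dots> \<le> ((C * real N) powr t * x powr (t - 1) * (2 / real N)) * (4 * x)"
        using G_sum by (intro mult_left_mono) auto
      also have "\<dots> = 8 * C powr t * (real N powr t / real N) * (x powr (t - 1) * x)"
        using C by (simp add: powr_mult)
      also have "real N powr t / real N = real N powr (t - 1)"
        using N by (simp add: powr_diff)
      also have "real N powr (t - 1) = real K powr (t - 1) * (real n)\<^sup>2 powr (t - 1)"
        by (simp add: N_def powr_mult)
      also have "x powr (t - 1) * x = x powr t"
        using x0 by (cases "x = 0") (auto simp: powr_diff)
      finally show "(\<Sum>k<N. B k * (2 / real N)) \<le> D * (real n)\<^sup>2 powr (t - 1) * x powr t"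
        by (simp add: D_def mult_ac)
    qed
    finally show "(\<integral>\<^sup>+x\<in>{-1..1}. ennreal (\<bar>poly P x\<bar> powr q * (w x * u x)) \<partial>lebesgue) \<le>
      ennreal (D * (real n)\<^sup>2 powr (t - 1) * enn2real X powr t)" by (simp add: x_def)
  qed
qed

text \<open>As \<open>A_star\<close> bounds u at every point of a cell by L times the cell average,
  the estimate from cell to cell becomes pointwise; its decay factor is estimated by 1. The point -1
  is left out because it lies in no cell.\<close>

lemma nikolskii_sup:
  fixes p :: real
  assumes u: "u \<in> A_star" and w: "continuous_on {-1..1} w" and p: "0 < p"
    and out: "\<And>y. y \<in> {-1..1} \<Longrightarrow> increasing_outward {-1..1} w y"
    and nonneg: "\<And>x. x \<in> {-1..1} \<Longrightarrow> 0 \<le> w x"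
  shows "\<exists>D>0. \<forall>n\<ge>1. \<forall>P :: real poly. degree P \<le> n \<longrightarrow>
      (\<integral>\<^sup>+x\<in>{-1..1}. ennreal (\<bar>poly P x\<bar> powr p * (w x * u x) powr p) \<partial>lebesgue) \<noteq> \<infinity> \<longrightarrow>
      (\<forall>x\<in>{-1<..1}. \<bar>poly P x * (w x * u x)\<bar> \<le> D * real n powr (2 / p) *
        enn2real (\<integral>\<^sup>+x\<in>{-1..1}. ennreal (\<bar>poly P x\<bar> powr p * (w x * u x) powr p) \<partial>lebesgue) powr (1 / p))"
proof -
  have ru: "regular_weight u" using u by (rule A_star_regular)
  have wt: "weight u" using u by (simp add: A_star_def)
  obtain L where L: "L \<ge> 1"
    and star: "\<And>a b x. -1 \<le> a \<Longrightarrow> a < b \<Longrightarrow> b \<le> 1 \<Longrightarrow> x \<in> {a<..b} \<Longrightarrow> u x \<le> L * (mass u a b / (b - a))"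
    using A_star_bound[OF u] by metis
  obtain K :: nat and C where K: "K \<ge> 1" and C: "C > 0" and bound:
    "\<And>n (P :: real poly) k x. \<lbrakk>n \<ge> 1; degree P \<le> n; k < K * n\<^sup>2; x \<in> cell (K * n\<^sup>2) k\<rbrakk> \<Longrightarrow>
      \<exists>j<K * n\<^sup>2. ennreal (\<bar>poly P x\<bar> powr p * (w x * cell_average u (K * n\<^sup>2) k) powr p) \<le>
        ennreal (C * real (K * n\<^sup>2) / (1 + \<bar>real j - real k\<bar>)\<^sup>2) *
        (\<integral>\<^sup>+y\<in>cell (K * n\<^sup>2) j. ennreal (\<bar>poly P y\<bar> powr p * (w y * u y) powr p) \<partial>lebesgue)"
    by (rule weighted_cell_bound[OF ru p p out nonneg]) (assumption, assumption, (rule that; blast))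
  define D where "D = L * (C * real K) powr (1 / p)"
  have D: "D > 0" unfolding D_def using C K L by simp
  show ?thesis
  proof (intro exI[of _ D] conjI D allI impI ballI)
    fix n :: nat and P :: "real poly" and x :: real
    assume n: "1 \<le> n" and deg: "degree P \<le> n" and x: "x \<in> {-1<..1}"
    define N where "N = K * n\<^sup>2"
    have N: "N \<ge> 1" using K n by (simp add: N_def)
    define X where "X = (\<integral>\<^sup>+x\<in>{-1..1}. ennreal (\<bar>poly P x\<bar> powr p * (w x * u x) powr p) \<partial>lebesgue)"
    assume "X \<noteq> \<infinity>"
    obtain k where k: "k < N" "x \<in> cell N k" using cell_cover[OF x N] by blast
    have x1: "x \<in> {-1..1}" using x by auto
    define a where "a = cell_average u N k"
    have a0: "0 \<le> a" unfolding a_def by (rule cell_average_nonneg[OF wt k(1)])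
    have wx: "0 \<le> w x" by (rule nonneg[OF x1])
    define A where "A = \<bar>poly P x\<bar> powr p * (w x * a) powr p"
    obtain j where j: "j < N" "ennreal A \<le> ennreal (C * real N / (1 + \<bar>real j - real k\<bar>)\<^sup>2) *
        (\<integral>\<^sup>+y\<in>cell N j. ennreal (\<bar>poly P y\<bar> powr p * (w y * u y) powr p) \<partial>lebesgue)"
      using bound[OF n deg, of k x] k unfolding N_def[symmetric] A_def a_def by blast
    have "ennreal A \<le> ennreal (C * real N) * X"
    proof (rule order_trans[OF j(2)], rule mult_mono)
      have "C * real N / (1 + \<bar>real j - real k\<bar>)\<^sup>2 \<le> C * real N / 1"
        using C by (intro divide_left_mono) auto
      then show "ennreal (C * real N / (1 + \<bar>real j - real k\<bar>)\<^sup>2) \<le> ennreal (C * real N)"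
        by (intro ennreal_leI) simp
      show "(\<integral>\<^sup>+y\<in>cell N j. ennreal (\<bar>poly P y\<bar> powr p * (w y * u y) powr p) \<partial>lebesgue) \<le> X"
        unfolding X_def using cell_subset[OF j(1)]
        by (intro nn_integral_mono) (auto simp: indicator_def)
    qed auto
    also have "\<dots> = ennreal (C * real N * enn2real X)"
      using \<open>X \<noteq> \<infinity>\<close> C by (simp add: ennreal_mult less_top)
    finally have "A \<le> C * real N * enn2real X" using C by (subst (asm) ennreal_le_iff) auto
    then have "A powr (1 / p) \<le> (C * real N * enn2real X) powr (1 / p)"
      using p by (intro powr_mono2) (auto simp: A_def)
    moreover have "A powr (1 / p) = \<bar>poly P x\<bar> * (w x * a)"
      unfolding A_def using p a0 wx by (simp add: powr_mult powr_powr)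
    moreover have "(C * real N * enn2real X) powr (1 / p) =
        (C * real K) powr (1 / p) * real n powr (2 / p) * enn2real X powr (1 / p)"
      using C n by (simp add: N_def powr_mult square_powr)
    ultimately have Pa: "\<bar>poly P x\<bar> * (w x * a) \<le> (C * real K) powr (1 / p) * real n powr (2 / p) * enn2real X powr (1 / p)"
      by simp
    have ux: "0 \<le> u x" using wt x1 by (simp add: weight_def)
    have "u x \<le> L * a"
    proof -
      define s e where "s = -1 + 2 * real k / real N" and "e = -1 + 2 * (real k + 1) / real N"
      have "e - s = 2 / real N" by (simp add: s_def e_def diff_divide_distrib[symmetric])
      moreover have "0 < 2 / real N" using N by simp
      ultimately have "s < e" by linarith
      moreover have "-1 \<le> s" "e \<le> 1" using k(1) by (auto simp: s_def e_def field_simps)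
      moreover have "x \<in> {s<..e}" using k(2) by (simp add: cell_def s_def e_def)
      ultimately have "u x \<le> L * (mass u s e / (e - s))" by (intro star)
      then show ?thesis unfolding a_def s_def e_def using cell_average_mass[OF N, of u k] by simp
    qed
    then have "\<bar>poly P x\<bar> * (w x * u x) \<le> \<bar>poly P x\<bar> * (w x * (L * a))"
      using wx by (intro mult_left_mono) auto
    also have "\<dots> = L * (\<bar>poly P x\<bar> * (w x * a))" by simp
    also have "\<dots> \<le> L * ((C * real K) powr (1 / p) * real n powr (2 / p) * enn2real X powr (1 / p))"
      using Pa L by (intro mult_left_mono) auto
    finally show "\<bar>poly P x * (w x * u x)\<bar> \<le> D * real n powr (2 / p) * enn2real X powr (1 / p)"
      using wx ux by (simp add: abs_mult D_def mult_ac)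
  qed
qed

lemma Lp_norm_real:
  assumes "0 < q"
  shows "Lp_norm (ennreal q) w f =
    (let J = (\<integral>\<^sup>+x\<in>{-1..1}. ennreal (\<bar>f x\<bar> powr q * w x) \<partial>lebesgue)
     in if J = \<infinity> then \<infinity> else ennreal (enn2real J powr (1 / q)))"
proof -
  have "enn2real (ennreal q) = q" using assms by simp
  then show ?thesis unfolding Lp_norm_def Let_def by simp
qed

theorem corollary8p2:
  fixes s :: nat and \<omega>s :: "nat \<Rightarrow> real \<Rightarrow> real" and \<omega> :: "real \<Rightarrow> real"
  assumes "s \<ge> 1"
    and "\<And>i. i \<in> {1..s} \<Longrightarrow> (\<lambda>t. \<omega>s i (cos t)) \<in> Omega"
    and "\<And>x. x \<in> {-1..1} \<Longrightarrow> \<omega> x = (\<Prod>i=1..s. \<omega>s i x)"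
  shows
    "(\<forall>(p::real) (q::real) u. 0 < p \<and> p \<le> q \<and> u \<in> A_infinity \<longrightarrow>
        (\<exists>C>0. \<forall>n\<ge>1. \<forall>P::real poly. degree P \<le> n \<longrightarrow>
           Lp_norm (ennreal q) (\<lambda>x. \<omega> x * u x) (poly P)
             \<le> ennreal (C * real n powr (2 / p - 2 / q))
               * Lp_norm (ennreal p) (\<lambda>x. (\<omega> x * u x) powr (p / q)) (poly P))) \<and>
     (\<forall>(p::real) u. 0 < p \<and> u \<in> A_star \<longrightarrow>
        (\<exists>C>0. \<forall>n\<ge>1. \<forall>P::real poly. degree P \<le> n \<longrightarrow>
           Lp_norm \<infinity> (\<lambda>x. \<omega> x * u x) (poly P)
             \<le> ennreal (C * real n powr (2 / p))
               * Lp_norm (ennreal p) (\<lambda>x. (\<omega> x * u x) powr p) (poly P)))"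
proof -
  note \<omega>s = Omega_cos_properties[OF assms(2)]
  have cont: "continuous_on {-1..1} \<omega>"
  proof (rule continuous_on_eq)
    show "continuous_on {-1..1} (\<lambda>x. \<Prod>i=1..s. \<omega>s i x)" using \<omega>s(1) by (intro continuous_on_prod) auto
  qed (simp add: assms(3))
  have nonneg: "0 \<le> \<omega> x" if "x \<in> {-1..1}" for x
    unfolding assms(3)[OF that] using \<omega>s(2) that by (intro prod_nonneg) auto
  have out: "increasing_outward {-1..1} \<omega> y" if "y \<in> {-1..1}" for y
  proof -
    have "increasing_outward {-1..1} (\<lambda>x. \<Prod>i=1..s. \<omega>s i x) y"
      using \<omega>s that by (intro increasing_outward_prod) auto
    then show ?thesis unfolding increasing_outward_def using assms(3) by simp
  qed
  show ?thesis
  proof (intro conjI allI impI; elim conjE)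
    fix p q :: real and u
    assume p: "0 < p" and pq: "p \<le> q" and u: "u \<in> A_infinity"
    obtain D where D: "D > 0" and bound: "\<And>n (P :: real poly). n \<ge> 1 \<Longrightarrow> degree P \<le> n \<Longrightarrow>
      (\<integral>\<^sup>+x\<in>{-1..1}. ennreal (\<bar>poly P x\<bar> powr p * (\<omega> x * u x) powr (p / q)) \<partial>lebesgue) \<noteq> \<infinity> \<Longrightarrow>
      (\<integral>\<^sup>+x\<in>{-1..1}. ennreal (\<bar>poly P x\<bar> powr q * (\<omega> x * u x)) \<partial>lebesgue) \<le>
      ennreal (D * (real n)\<^sup>2 powr (q / p - 1) *
        enn2real (\<integral>\<^sup>+x\<in>{-1..1}. ennreal (\<bar>poly P x\<bar> powr p * (\<omega> x * u x) powr (p / q)) \<partial>lebesgue) powr (q / p))"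
      using nikolskii_integral[OF A_infinity_regular[OF u] cont p pq out nonneg] by blast
    have q: "0 < q" using p pq by simp
    show "\<exists>C>0. \<forall>n\<ge>1. \<forall>P::real poly. degree P \<le> n \<longrightarrow>
           Lp_norm (ennreal q) (\<lambda>x. \<omega> x * u x) (poly P)
             \<le> ennreal (C * real n powr (2 / p - 2 / q))
               * Lp_norm (ennreal p) (\<lambda>x. (\<omega> x * u x) powr (p / q)) (poly P)"
    \<comment> \<open>The q-th root of the integral inequality turns the exponent of n into 2 (q / p
      - 1) / q = 2 / p - 2 / q.\<close>
    proof (intro exI[of _ "D powr (1 / q)"] conjI allI impI)
      show "D powr (1 / q) > 0" using D by simp
      fix n :: nat and P :: "real poly" assume n: "1 \<le> n" and deg: "degree P \<le> n"
      define X where "X = (\<integral>\<^sup>+x\<in>{-1..1}. ennreal (\<bar>poly P x\<bar> powr p * (\<omega> x * u x) powr (p / q)) \<partial>lebesgue)"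
      define Y where "Y = (\<integral>\<^sup>+x\<in>{-1..1}. ennreal (\<bar>poly P x\<bar> powr q * (\<omega> x * u x)) \<partial>lebesgue)"
      show "Lp_norm (ennreal q) (\<lambda>x. \<omega> x * u x) (poly P)
             \<le> ennreal (D powr (1 / q) * real n powr (2 / p - 2 / q))
               * Lp_norm (ennreal p) (\<lambda>x. (\<omega> x * u x) powr (p / q)) (poly P)"
        unfolding Lp_norm_real[OF p] Lp_norm_real[OF q] X_def[symmetric] Y_def[symmetric] Let_def
      proof (cases "X = \<infinity>")
        \<comment> \<open>An infinite integral makes the right-hand side infinite, as its
          coefficient is positive.\<close>
        case True
        then show "(if Y = \<infinity> then \<infinity> else ennreal (enn2real Y powr (1 / q))) \<le>
          ennreal (D powr (1 / q) * real n powr (2 / p - 2 / q)) *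
          (if X = \<infinity> then \<infinity> else ennreal (enn2real X powr (1 / p)))"
          using D n by (simp add: ennreal_mult_top)
      next
        case False
        define B where "B = D * (real n)\<^sup>2 powr (q / p - 1) * enn2real X powr (q / p)"
        have Y: "Y \<le> ennreal B" unfolding Y_def B_def X_def
          using False by (intro bound n deg) (simp add: X_def)
        then have "Y \<noteq> \<infinity>" by (auto simp: top_unique)
        have B0: "0 \<le> B" using D by (simp add: B_def)
        have "enn2real Y \<le> B" using enn2real_mono[OF Y] B0 by simp
        then have "enn2real Y powr (1 / q) \<le> B powr (1 / q)" using q by (intro powr_mono2) auto
        also have "\<dots> = D powr (1 / q) * real n powr (2 * ((q / p - 1) / q)) * enn2real X powr (1 / p)"
          unfolding B_def using D n q by (simp add: powr_mult powr_powr square_powr)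
        also have "2 * ((q / p - 1) / q) = 2 / p - 2 / q" using p q by (simp add: field_simps)
        finally show "(if Y = \<infinity> then \<infinity> else ennreal (enn2real Y powr (1 / q))) \<le>
          ennreal (D powr (1 / q) * real n powr (2 / p - 2 / q)) *
          (if X = \<infinity> then \<infinity> else ennreal (enn2real X powr (1 / p)))"
          using False \<open>Y \<noteq> \<infinity>\<close> D by (simp add: ennreal_mult[symmetric] ennreal_leI)
      qed
    qed
  next
    fix p :: real and u
    assume p: "0 < p" and u: "u \<in> A_star"
    have wt: "weight u" using u by (simp add: A_star_def)
    obtain D where D: "D > 0" and bound: "\<And>n (P :: real poly). n \<ge> 1 \<Longrightarrow> degree P \<le> n \<Longrightarrow>
      (\<integral>\<^sup>+x\<in>{-1..1}. ennreal (\<bar>poly P x\<bar> powr p * (\<omega> x * u x) powr p) \<partial>lebesgue) \<noteq> \<infinity> \<Longrightarrow>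
      (\<forall>x\<in>{-1<..1}. \<bar>poly P x * (\<omega> x * u x)\<bar> \<le> D * real n powr (2 / p) *
        enn2real (\<integral>\<^sup>+x\<in>{-1..1}. ennreal (\<bar>poly P x\<bar> powr p * (\<omega> x * u x) powr p) \<partial>lebesgue) powr (1 / p))"
      using nikolskii_sup[OF u cont p out nonneg] by blast
    show "\<exists>C>0. \<forall>n\<ge>1. \<forall>P::real poly. degree P \<le> n \<longrightarrow>
           Lp_norm \<infinity> (\<lambda>x. \<omega> x * u x) (poly P)
             \<le> ennreal (C * real n powr (2 / p))
               * Lp_norm (ennreal p) (\<lambda>x. (\<omega> x * u x) powr p) (poly P)"
    proof (intro exI[of _ D] conjI allI impI D)
      fix n :: nat and P :: "real poly" assume n: "1 \<le> n" and deg: "degree P \<le> n"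
      define X where "X = (\<integral>\<^sup>+x\<in>{-1..1}. ennreal (\<bar>poly P x\<bar> powr p * (\<omega> x * u x) powr p) \<partial>lebesgue)"
      show "Lp_norm \<infinity> (\<lambda>x. \<omega> x * u x) (poly P)
             \<le> ennreal (D * real n powr (2 / p))
               * Lp_norm (ennreal p) (\<lambda>x. (\<omega> x * u x) powr p) (poly P)"
        unfolding Lp_norm_real[OF p] X_def[symmetric] Let_def
      proof (cases "X = \<infinity>")
        case True
        then show "Lp_norm \<infinity> (\<lambda>x. \<omega> x * u x) (poly P) \<le> ennreal (D * real n powr (2 / p)) *
          (if X = \<infinity> then \<infinity> else ennreal (enn2real X powr (1 / p)))"
          using D n by (simp add: ennreal_mult_top)
      next
        case False
        have "esssup (lebesgue_on {-1..1}) (\<lambda>x. ennreal \<bar>poly P x * (\<omega> x * u x)\<bar>) \<le>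
          ennreal (D * real n powr (2 / p) * enn2real X powr (1 / p))"
        proof (rule esssup_I)
          \<comment> \<open>Measurability is available for the cut-off product, which agrees with
            the product itself on [-1, 1].\<close>
          note [measurable] = product_weight_measurable[OF wt cont] poly_borel_measurable[of P]
          have "(\<lambda>x. ennreal \<bar>poly P x * (indicat_real {-1..1} x * (\<omega> x * u x))\<bar>) \<in> borel_measurable lebesgue"
            by measurable
          then have "(\<lambda>x. ennreal \<bar>poly P x * (indicat_real {-1..1} x * (\<omega> x * u x))\<bar>) \<in> borel_measurable (lebesgue_on {-1..1})"
            by (rule measurable_restrict_space1)
          then show "(\<lambda>x. ennreal \<bar>poly P x * (\<omega> x * u x)\<bar>) \<in> borel_measurable (lebesgue_on {-1..1})"
            by (rule measurable_cong[THEN iffD1, rotated]) (auto simp: space_restrict_space)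
          \<comment> \<open>The pointwise bound misses only the null set consisting of -1.\<close>
          have "AE x in lebesgue. x \<noteq> (-1::real)"
            by (rule AE_completion) (rule AE_lborel_singleton)
          then have "AE x in lebesgue. x \<in> {-1..1} \<longrightarrow> ennreal \<bar>poly P x * (\<omega> x * u x)\<bar> \<le>
            ennreal (D * real n powr (2 / p) * enn2real X powr (1 / p))"
          proof eventually_elim
            case (elim x)
            show ?case
            proof
              assume "x \<in> {-1..1}"
              then have "x \<in> {-1<..1}" using elim by auto
              then show "ennreal \<bar>poly P x * (\<omega> x * u x)\<bar> \<le>
                  ennreal (D * real n powr (2 / p) * enn2real X powr (1 / p))"
                using bound[OF n deg] False unfolding X_def by (intro ennreal_leI) blast
            qed
          qed
          then show "AE x in lebesgue_on {-1..1}. ennreal \<bar>poly P x * (\<omega> x * u x)\<bar> \<le>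
            ennreal (D * real n powr (2 / p) * enn2real X powr (1 / p))"
            by (subst AE_restrict_space_iff) auto
        qed
        then show "Lp_norm \<infinity> (\<lambda>x. \<omega> x * u x) (poly P) \<le> ennreal (D * real n powr (2 / p)) *
          (if X = \<infinity> then \<infinity> else ennreal (enn2real X powr (1 / p)))"
          using False D by (simp add: Lp_norm_def ennreal_mult[symmetric])
      qed
    qed
  qed
qed

end
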